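(* Let $n\ge2$, $q\ge2$, $s\ge1$ be integers and let $C\subseteq[q]^n$ be a $(2s-1)$-design with degree $s$ in $H(n,q)$, with degree set $\{\alpha_1<\alpha_2<\cdots<\alpha_s\}$; put $\alpha_0=0$. For $i\in[q]$ let $C_i=\{(x_2,\ldots,x_n)\mid(i,x_2,\ldots,x_n)\in C\}\subseteq[q]^{n-1}$ and let $\widetilde C=\{(i,x):i\in[q],x\in C_i\}$ (the disjoint union of the $C_i$). Define relations on $\widetilde C$: $R_0$ the identity relation; for $1\le j\le s$, $T_j=\{((i,x),(i,y)):x\ne y,\ \partial(x,y)=\alpha_j\}$ (same block); and $U_j=\{((i,x),(k,y)):i\ne k,\ \partial(x,y)=\alpha_j-1\}$ (different blocks). Let $M_{n-1,q}[x_1,\ldots,x_r]$ denote the $r\times s$ matrix whose $(a,b)$ entry is $K_{n-1,q,b}(x_a)$, $1\le a\le r$, $0\le b\le s-1$. (1) If $C$ is tight, then $(\widetilde C,\{R_0,T_1,\ldots,T_{s-1},U_1,\ldots,U_s\})$ is an association scheme of $2s-1$ classes whose second eigenmatrix (rows indexed by the relations in the listed order, columns by the primitive idempotents in a suitable order) is \[ Q=\begin{bmatrix} M_{n-1,q}[\alpha_0,\ldots,\alpha_{s-1}] & (q-1)M_{n-1,q}[\alpha_0,\ldots,\alpha_{s-1}]\\ M_{n-1,q}[\alpha_1-1,\ldots,\alpha_s-1] & -M_{n-1,q}[\alpha_1-1,\ldots,\alpha_s-1]\end{bmatrix}. \] (2) If $C$ is not tight, then $(\widetilde C,\{R_0,T_1,\ldots,T_s,U_1,\ldots,U_s\})$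 is an association scheme of $2s$ classes whose second eigenmatrix (rows indexed by the relations in the listed order, columns by the primitive idempotents in a suitable order) is \[ Q=\begin{bmatrix} M_{n-1,q}[\alpha_0,\ldots,\alpha_{s}] & \mathbf c & (q-1)M_{n-1,q}[\alpha_0,\ldots,\alpha_{s}]\\ M_{n-1,q}[\alpha_1-1,\ldots,\alpha_s-1] & O_{s\times1} & -M_{n-1,q}[\alpha_1-1,\ldots,\alpha_s-1]\end{bmatrix}, \] where $\mathbf c=(c_0,\ldots,c_s)^\top$ with $c_0=|C|-q\sum_{\ell=0}^{s-1}K_{n-1,q,\ell}(\alpha_0)$ and $c_i=-q\sum_{\ell=0}^{s-1}K_{n-1,q,\ell}(\alpha_i)$ for $1\le i\le s$.
   Context: $[q]=\{1,\ldots,q\}$; $\partial$ is Hamming distance. $K_{m,q,j}(x)=\sum_{\ell=0}^j(-1)^\ell(q-1)^{j-\ell}\binom{x}{\ell}\binom{m-x}{j-\ell}$ (Krawtchouk polynomial). A nonempty $C\subseteq[q]^n$ is a $t$-design in the Hamming scheme $H(n,q)$ if the array of its elements (as rows) is an orthogonal array of strength $t$: in any $t$ columns every element of $[q]^t$ occurs equally often. Its degree set is $\{\partial(x,y):x,y\in C,x\ne y\}$ and its degree is the size of this set. A $(2s-1)$-design is tight if $|C|=\sum_{k=0}^{s-1}\binom{n}{k}(q-1)^k+\binom{n-1}{s-1}(q-1)^s$. For a symmetric association scheme on a set $X$ with adjacency matrices $A_0=I,\ldots,A_D$ and primitive idempotents $E_0=\frac1{|X|}J,\ldots,E_D$ of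 its Bose–Mesner algebra, the second eigenmatrix $Q$ is given by $E_j=\frac{1}{|X|}\sum_i Q_{ij}A_i$. *)

theory Defs
  imports Complex_Main "Jordan_Normal_Form.Matrix"
begin

section \<open>Symmetric association schemes\<close>

definition association_scheme :: "'a set \<Rightarrow> nat \<Rightarrow> (nat \<Rightarrow> ('a \<times> 'a) set) \<Rightarrow> bool" where
  "association_scheme X D R \<longleftrightarrow>
     finite X \<and> X \<noteq> {} \<and>
     R 0 = Id_on X \<and>
     (\<forall>i\<le>D. R i \<noteq> {} \<and> sym (R i)) \<and>
     (\<forall>i\<le>D. \<forall>j\<le>D. i \<noteq> j \<longrightarrow> R i \<inter> R j = {}) \<and>
     (\<Union>i\<le>D. R i) = X \<times> X \<and>
     (\<forall>i\<le>D. \<forall>j\<le>D. \<forall>k\<le>D. \<exists>p. \<forall>(x, y)\<in>R k.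
        card {z \<in> X. (x, z) \<in> R i \<and> (z, y) \<in> R j} = p)"

text \<open>Matrices with rows and columns indexed by \<^term>\<open>X\<close> are functions
  \<^typ>\<open>'a \<Rightarrow> 'a \<Rightarrow> real\<close> that vanish outside \<^term>\<open>X \<times> X\<close>; equality of such matrices is
  equality of functions.\<close>

definition adjacency :: "('a \<times> 'a) set \<Rightarrow> 'a \<Rightarrow> 'a \<Rightarrow> real" where
  "adjacency r = (\<lambda>x y. if (x, y) \<in> r then 1 else 0)"

definition mat_prod_on :: "'a set \<Rightarrow> ('a \<Rightarrow> 'a \<Rightarrow> real) \<Rightarrow> ('a \<Rightarrow> 'a \<Rightarrow> real) \<Rightarrow> 'a \<Rightarrow> 'a \<Rightarrow> real" where
  "mat_prod_on X M N = (\<lambda>x y. \<Sum>z\<in>X. M x z * N z y)"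

definition bose_mesner :: "nat \<Rightarrow> (nat \<Rightarrow> ('a \<times> 'a) set) \<Rightarrow> ('a \<Rightarrow> 'a \<Rightarrow> real) set" where
  "bose_mesner D R = {M. \<exists>c. M = (\<lambda>x y. \<Sum>i\<le>D. c i * adjacency (R i) x y)}"

definition bm_idempotents ::
    "'a set \<Rightarrow> nat \<Rightarrow> (nat \<Rightarrow> ('a \<times> 'a) set) \<Rightarrow> ('a \<Rightarrow> 'a \<Rightarrow> real) set" where
  "bm_idempotents X D R = {E \<in> bose_mesner D R. mat_prod_on X E E = E}"

definition primitive_idempotents ::
    "'a set \<Rightarrow> nat \<Rightarrow> (nat \<Rightarrow> ('a \<times> 'a) set) \<Rightarrow> ('a \<Rightarrow> 'a \<Rightarrow> real) set" where
  "primitive_idempotents X D R =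
     {E \<in> bm_idempotents X D R. E \<noteq> (\<lambda>x y. 0) \<and>
        (\<forall>F\<in>bm_idempotents X D R. \<forall>G\<in>bm_idempotents X D R.
           E = (\<lambda>x y. F x y + G x y) \<and>
           mat_prod_on X F G = (\<lambda>x y. 0) \<and> mat_prod_on X G F = (\<lambda>x y. 0) \<longrightarrow>
           F = (\<lambda>x y. 0) \<or> G = (\<lambda>x y. 0))}"

text \<open>The rows of \<^term>\<open>Q\<close> follow the given order of the relations; the columns follow
  some enumeration of all primitive idempotents that starts with \<open>J / |X|\<close>.\<close>

definition second_eigenmatrix ::
    "'a set \<Rightarrow> nat \<Rightarrow> (nat \<Rightarrow> ('a \<times> 'a) set) \<Rightarrow> real mat \<Rightarrow> bool" where
  "second_eigenmatrix X D R Q \<longleftrightarrow>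
     Q \<in> carrier_mat (D + 1) (D + 1) \<and>
     (\<exists>E. bij_betw E {..D} (primitive_idempotents X D R) \<and>
          E 0 = (\<lambda>x y. 1 / real (card X) * adjacency (X \<times> X) x y) \<and>
          (\<forall>j\<le>D. E j = (\<lambda>x y. 1 / real (card X) * (\<Sum>i\<le>D. Q $$ (i, j) * adjacency (R i) x y))))"

section \<open>Designs in the Hamming scheme\<close>

definition words :: "nat \<Rightarrow> nat \<Rightarrow> nat list set" where
  "words q n = {x. length x = n \<and> set x \<subseteq> {1..q}}"

definition hamming_dist :: "'a list \<Rightarrow> 'a list \<Rightarrow> nat" where
  "hamming_dist x y = card {k. k < length x \<and> x ! k \<noteq> y ! k}"

text \<open>An orthogonal array of strength \<^term>\<open>t\<close> has at least \<^term>\<open>t\<close> columns; without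
  \<^prop>\<open>t \<le> n\<close> the last condition would be vacuous for \<^prop>\<open>t > n\<close>.\<close>

definition hamming_design :: "nat \<Rightarrow> nat \<Rightarrow> nat \<Rightarrow> nat list set \<Rightarrow> bool" where
  "hamming_design n q t C \<longleftrightarrow>
     C \<noteq> {} \<and> C \<subseteq> words q n \<and> t \<le> n \<and>
     (\<forall>S\<subseteq>{..<n}. card S = t \<longrightarrow>
        (\<exists>l. \<forall>w\<in>words q t. card {x \<in> C. nths x S = w} = l))"

definition degree_set :: "nat list set \<Rightarrow> nat set" where
  "degree_set C = {hamming_dist x y | x y. x \<in> C \<and> y \<in> C \<and> x \<noteq> y}"

definition code_degree :: "nat list set \<Rightarrow> nat" where
  "code_degree C = card (degree_set C)"

definition tight_odd_design :: "nat \<Rightarrow> nat \<Rightarrow> nat \<Rightarrow> nat list set \<Rightarrow> bool" where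
  "tight_odd_design n q s C \<longleftrightarrow>
     hamming_design n q (2 * s - 1) C \<and>
     card C = (\<Sum>k = 0..s - 1. (n choose k) * (q - 1) ^ k) + ((n - 1) choose (s - 1)) * (q - 1) ^ s"

section \<open>The blocks of a code with respect to the first coordinate\<close>

definition code_block :: "nat list set \<Rightarrow> nat \<Rightarrow> nat list set" where
  "code_block C i = {x. i # x \<in> C}"

definition block_union :: "nat \<Rightarrow> nat list set \<Rightarrow> (nat \<times> nat list) set" where
  "block_union q C = (SIGMA i:{1..q}. code_block C i)"

definition same_block_rel ::
    "nat \<Rightarrow> nat list set \<Rightarrow> nat \<Rightarrow> ((nat \<times> nat list) \<times> (nat \<times> nat list)) set" where
  "same_block_rel q C d =
     {((i, x), (i, y)) | i x y. i \<in> {1..q} \<and> x \<in> code_block C i \<and> y \<in> code_block C i \<and>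
        x \<noteq> y \<and> hamming_dist x y = d}"

definition diff_block_rel ::
    "nat \<Rightarrow> nat list set \<Rightarrow> nat \<Rightarrow> ((nat \<times> nat list) \<times> (nat \<times> nat list)) set" where
  "diff_block_rel q C d =
     {((i, x), (k, y)) | i x k y. i \<in> {1..q} \<and> k \<in> {1..q} \<and>
        x \<in> code_block C i \<and> y \<in> code_block C k \<and> i \<noteq> k \<and> hamming_dist x y = d}"

section \<open>Krawtchouk matrices\<close>

definition krawtchouk :: "nat \<Rightarrow> nat \<Rightarrow> nat \<Rightarrow> real \<Rightarrow> real" where
  "krawtchouk m q j x =
     (\<Sum>l = 0..j. (-1) ^ l * (real q - 1) ^ (j - l) * (x gchoose l) * ((real m - x) gchoose (j - l)))"

definition krawtchouk_mat :: "nat \<Rightarrow> nat \<Rightarrow> nat \<Rightarrow> real list \<Rightarrow> real mat" where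
  "krawtchouk_mat m q s xs = mat (length xs) s (\<lambda>(a, b). krawtchouk m q b (xs ! a))"

text \<open>Horizontal counterpart of \<^const>\<open>append_rows\<close>.\<close>

definition beside :: "'a :: zero mat \<Rightarrow> 'a mat \<Rightarrow> 'a mat" where
  "beside A B = four_block_mat A B (0\<^sub>m 0 (dim_col A)) (0\<^sub>m 0 (dim_col B))"

end

theory Submission
  imports Defs "Jordan_Normal_Form.Determinant"
begin

text \<open>For a set \<open>S\<close> of coordinates put \<open>F\<^sub>S(x, y) = \<Prod>\<^bsub>k\<in>S\<^esub> (q [x\<^sub>k = y\<^sub>k] - 1)\<close>. On a design of strength
  \<open>t\<close> these kernels satisfy \<open>F\<^sub>S F\<^sub>S\<^sub>' = \<delta>\<^bsub>S,S'\<^esub> |C| F\<^sub>S\<close> whenever \<open>|S \<union> S'| \<le> t\<close>. Summing over the sets of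
  size \<open>j < s\<close> that avoid the first coordinate, and over the same sets with the first coordinate
  added, gives \<open>2s\<close> orthogonal idempotents whose entries are Krawtchouk polynomials in the
  distance of the tails. Together with the complement of their sum, which vanishes exactly if
  \<open>C\<close> is tight, they are as many as the relations, hence a basis of the span of the adjacency
  matrices. In the tight case it remains to see that \<open>T\<^sub>s\<close> is empty: the vanishing complement
  leaves at most \<open>s - 1\<close> distances inside blocks, and a quadrature argument excludes \<open>\<alpha>\<^sub>s\<close>.\<close>

section \<open>Association schemes from orthogonal idempotents\<close>

lemma adjacency_partition_sum:
  fixes D :: nat
  assumes "\<And>i j. i \<le> D \<Longrightarrow> j \<le> D \<Longrightarrow> i \<noteq> j \<Longrightarrow> R i \<inter> R j = {}"
    and "k \<le> D" and "(x, y) \<in> R k"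
  shows "(\<Sum>i\<le>D. c i * adjacency (R i) x y) = c k"
proof -
  have "c i * adjacency (R i) x y = (if i = k then c k else 0)" if "i \<le> D" for i
    using assms(1)[of i k] assms(2,3) that by (auto simp: adjacency_def)
  then have "(\<Sum>i\<le>D. c i * adjacency (R i) x y) = (\<Sum>i\<le>D. if i = k then c k else 0)"
    by (intro sum.cong) auto
  also have "\<dots> = c k" using assms(2) by simp
  finally show ?thesis .
qed

lemma mat_prod_on_sum:
  "mat_prod_on X (\<lambda>x y. \<Sum>i\<in>I. a i * E i x y) (\<lambda>x y. \<Sum>j\<in>J. b j * F j x y) =
     (\<lambda>x y. \<Sum>i\<in>I. \<Sum>j\<in>J. a i * b j * mat_prod_on X (E i) (F j) x y)"
proof (intro ext)
  fix x y
  have "mat_prod_on X (\<lambda>x y. \<Sum>i\<in>I. a i * E i x y) (\<lambda>x y. \<Sum>j\<in>J. b j * F j x y) x y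
      = (\<Sum>z\<in>X. \<Sum>i\<in>I. \<Sum>j\<in>J. a i * b j * (E i x z * F j z y))"
    by (simp add: mat_prod_on_def sum_product algebra_simps)
  also have "\<dots> = (\<Sum>i\<in>I. \<Sum>z\<in>X. \<Sum>j\<in>J. a i * b j * (E i x z * F j z y))"
    by (rule sum.swap)
  also have "\<dots> = (\<Sum>i\<in>I. \<Sum>j\<in>J. \<Sum>z\<in>X. a i * b j * (E i x z * F j z y))"
    by (intro sum.cong refl sum.swap)
  finally show "mat_prod_on X (\<lambda>x y. \<Sum>i\<in>I. a i * E i x y) (\<lambda>x y. \<Sum>j\<in>J. b j * F j x y) x y
      = (\<Sum>i\<in>I. \<Sum>j\<in>J. a i * b j * mat_prod_on X (E i) (F j) x y)"
    by (simp add: mat_prod_on_def sum_distrib_left)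
qed

locale orthogonal_idempotents =
  fixes X :: "'a set" and D :: nat and E :: "nat \<Rightarrow> 'a \<Rightarrow> 'a \<Rightarrow> real"
  assumes prod: "\<And>i j. i \<le> D \<Longrightarrow> j \<le> D \<Longrightarrow> mat_prod_on X (E i) (E j) = (if i = j then E i else (\<lambda>x y. 0))"
    and nonzero: "\<And>i. i \<le> D \<Longrightarrow> E i \<noteq> (\<lambda>x y. 0)"
begin

text \<open>Coordinates with respect to the idempotents: \<open>prod_comb\<close> and
  \<open>comb_inj\<close> identify their span with the coefficient vectors on \<open>{..D}\<close>
  under componentwise multiplication.\<close>

definition comb :: "(nat \<Rightarrow> real) \<Rightarrow> 'a \<Rightarrow> 'a \<Rightarrow> real" where
  "comb c = (\<lambda>x y. \<Sum>i\<le>D. c i * E i x y)"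

lemma comb_unit: "i \<le> D \<Longrightarrow> comb (\<lambda>j. of_bool (j = i)) = E i"
  by (simp add: comb_def fun_eq_iff sum.delta' if_distrib if_distribR of_bool_def cong: if_cong)

lemma prod_comb: "mat_prod_on X (comb a) (comb b) = comb (\<lambda>i. a i * b i)"
proof -
  have "mat_prod_on X (comb a) (comb b) = (\<lambda>x y. \<Sum>i\<le>D. \<Sum>j\<le>D. a i * b j * mat_prod_on X (E i) (E j) x y)"
    unfolding comb_def mat_prod_on_sum ..
  also have "\<dots> = (\<lambda>x y. \<Sum>i\<le>D. \<Sum>j\<le>D. if j = i then a i * b j * E i x y else 0)"
    by (intro ext sum.cong refl) (auto simp: prod)
  finally show ?thesis by (simp add: comb_def)
qed

text \<open>Multiplication by \<open>E i\<close> isolates the term with index \<open>i\<close>, and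
  \<open>E i\<close> is not zero.\<close>

lemma comb_eq_0:
  assumes "comb a = (\<lambda>x y. 0)" "i \<le> D" shows "a i = 0"
proof -
  have "comb (\<lambda>j. a j * of_bool (j = i)) = (\<lambda>x y. 0)"
    using prod_comb[of a "\<lambda>j. of_bool (j = i)"] unfolding assms(1) by (simp add: mat_prod_on_def)
  then have "a i * E i x y = 0" for x y
    using assms(2) by (auto simp: comb_def fun_eq_iff sum.delta' if_distrib if_distribR of_bool_def cong: if_cong)
  then show ?thesis using nonzero[OF assms(2)] by (auto simp: fun_eq_iff)
qed

lemma comb_inj: "comb a = comb b \<Longrightarrow> i \<le> D \<Longrightarrow> a i = b i"
  using comb_eq_0[of "\<lambda>i. a i - b i" i]
  by (auto simp: comb_def fun_eq_iff left_diff_distrib sum_subtractf)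

lemma comb_add: "comb (\<lambda>i. a i + b i) = (\<lambda>x y. comb a x y + comb b x y)"
  by (simp add: comb_def fun_eq_iff distrib_right sum.distrib)

lemma comb_cong: "(\<And>i. i \<le> D \<Longrightarrow> a i = b i) \<Longrightarrow> comb a = comb b"
  by (auto simp: comb_def fun_eq_iff)

lemma inj_idempotents: "inj_on E {..D}"
proof
  fix i j assume *: "i \<in> {..D}" "j \<in> {..D}" "E i = E j"
  have "comb (\<lambda>k. of_bool (k = i)) = comb (\<lambda>k. of_bool (k = j))" using * by (simp add: comb_unit)
  from comb_inj[OF this, of i] * show "i = j" by (auto split: if_splits)
qed

text \<open>In coordinates an idempotent is a vector of zeros and ones. It is primitive iff exactly
  one entry is 1, because any further entry can be split off as an orthogonal summand.\<close>

lemma primitive_idempotents_eq: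
  assumes "bose_mesner D R = range comb"
  shows "primitive_idempotents X D R = E ` {..D}"
proof -
  have idem: "a i = 0 \<or> a i = 1" if "mat_prod_on X (comb a) (comb a) = comb a" "i \<le> D" for a i
    using comb_inj[OF that(1)[unfolded prod_comb] that(2)] by auto
  have bm: "bm_idempotents X D R = {comb a | a. mat_prod_on X (comb a) (comb a) = comb a}"
    unfolding bm_idempotents_def assms by auto
  have comb0: "comb a = (\<lambda>x y. 0)" if "\<And>i. i \<le> D \<Longrightarrow> a i = 0" for a
    using that by (simp add: comb_def)
  show ?thesis
  proof (intro equalityI subsetI)
    fix M assume M: "M \<in> primitive_idempotents X D R"
    then obtain a where a: "M = comb a" "mat_prod_on X (comb a) (comb a) = comb a" "comb a \<noteq> (\<lambda>x y. 0)"
      by (auto simp: primitive_idempotents_def bm)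
    then obtain j where j: "j \<le> D" "a j = 1" using comb0[of a] idem[of a] by blast
    \<comment> \<open>The unit vector \<open>u\<close> at \<open>j\<close> and the remainder
      \<open>b\<close> decompose \<open>M\<close> orthogonally; as \<open>comb u\<close> is nonzero,
      primitivity forces \<open>comb b\<close> to vanish.\<close>
    define b where "b = (\<lambda>i. a i * of_bool (i \<noteq> j))"
    define u :: "nat \<Rightarrow> real" where "u = (\<lambda>i. of_bool (i = j))"
    have "mat_prod_on X (comb u) (comb u) = comb u"
      unfolding prod_comb by (rule comb_cong) (auto simp: u_def)
    moreover have "mat_prod_on X (comb b) (comb b) = comb b"
      unfolding prod_comb using idem[OF a(2)] by (intro comb_cong) (auto simp: b_def)
    ultimately have "comb u \<in> bm_idempotents X D R" "comb b \<in> bm_idempotents X D R"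
      unfolding bm by auto
    moreover have "M = (\<lambda>x y. comb u x y + comb b x y)"
      unfolding a comb_add[symmetric] using j by (intro comb_cong) (auto simp: u_def b_def)
    moreover have "mat_prod_on X (comb u) (comb b) = (\<lambda>x y. 0)" "mat_prod_on X (comb b) (comb u) = (\<lambda>x y. 0)"
      unfolding prod_comb by (auto intro!: comb0 simp: u_def b_def)
    ultimately have "comb u = (\<lambda>x y. 0) \<or> comb b = (\<lambda>x y. 0)"
      using M unfolding primitive_idempotents_def by blast
    moreover have "comb u \<noteq> (\<lambda>x y. 0)" using nonzero[OF j(1)] j by (simp add: u_def comb_unit)
    ultimately have "M = comb u" using \<open>M = (\<lambda>x y. comb u x y + comb b x y)\<close> by simp
    then show "M \<in> E ` {..D}" using j by (simp add: u_def comb_unit)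
  next
    fix M assume "M \<in> E ` {..D}"
    then obtain j where j: "j \<le> D" "M = E j" by auto
    define u :: "nat \<Rightarrow> real" where "u = (\<lambda>i. of_bool (i = j))"
    have M: "M = comb u" using j by (simp add: u_def comb_unit)
    have "mat_prod_on X (comb u) (comb u) = comb u"
      unfolding prod_comb by (rule comb_cong) (auto simp: u_def)
    then have "M \<in> bm_idempotents X D R"
      unfolding bm M by auto
    moreover have "M \<noteq> (\<lambda>x y. 0)" using j nonzero by simp
    moreover have "F = (\<lambda>x y. 0) \<or> G = (\<lambda>x y. 0)"
      if FG: "F \<in> bm_idempotents X D R" "G \<in> bm_idempotents X D R" "M = (\<lambda>x y. F x y + G x y)"
        "mat_prod_on X F G = (\<lambda>x y. 0)" for F G
    proof -
      obtain a b where a: "F = comb a" "mat_prod_on X F F = F" and b: "G = comb b"  "mat_prod_on X G G = G"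
        using FG unfolding bm by auto
      have "comb u = comb (\<lambda>i. a i + b i)" using FG(3) unfolding M a(1) b(1) comb_add .
      note u = comb_inj[OF this]
      \<comment> \<open>Together with \<open>a i + b i = u i\<close>, this makes both coefficients
        vanish off \<open>j\<close> and one of them at \<open>j\<close>.\<close>
      have ab: "a i * b i = 0" if "i \<le> D" for i
        using comb_eq_0[OF FG(4)[unfolded a(1) b(1) prod_comb] that] .
      have zero: "a i = 0" "b i = 0" if "i \<le> D" "i \<noteq> j" for i
        using u[OF that(1)] ab[OF that(1)] that by (auto simp: u_def)
      from ab[OF j(1)] have "a j = 0 \<or> b j = 0" by simp
      then show ?thesis unfolding a(1) b(1) using zero comb0 by metis
    qed
    ultimately show "M \<in> primitive_idempotents X D R" unfolding primitive_idempotents_def by blast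
  qed
qed

end

text \<open>Linear independence of the idempotents makes the square matrix \<open>Q\<close> invertible, so the
  adjacency matrices lie in their span, which is closed under multiplication; the same
  argument shows that no relation is empty.\<close>

lemma association_scheme_of_idempotents:
  fixes e :: "nat \<Rightarrow> 'a \<Rightarrow> 'a \<Rightarrow> real"
  assumes X: "finite X" "X \<noteq> {}" and R0: "R 0 = Id_on X"
    and sym: "\<And>i. i \<le> D \<Longrightarrow> sym (R i)"
    and disj: "\<And>i j. i \<le> D \<Longrightarrow> j \<le> D \<Longrightarrow> i \<noteq> j \<Longrightarrow> R i \<inter> R j = {}"
    and union: "(\<Union>i\<le>D. R i) = X \<times> X"
    and Q: "Q \<in> carrier_mat (D + 1) (D + 1)" "\<And>i. i \<le> D \<Longrightarrow> Q $$ (i, 0) = 1"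
    and eQ: "\<And>i j x y. i \<le> D \<Longrightarrow> j \<le> D \<Longrightarrow> (x, y) \<in> R i \<Longrightarrow> real (card X) * e j x y = Q $$ (i, j)"
    and orth: "\<And>i j x y. i \<le> D \<Longrightarrow> j \<le> D \<Longrightarrow> x \<in> X \<Longrightarrow> y \<in> X \<Longrightarrow>
       (\<Sum>z\<in>X. e i x z * e j z y) = (if i = j then e i x y else 0)"
    and nz: "\<And>i. i \<le> D \<Longrightarrow> \<exists>x\<in>X. \<exists>y\<in>X. e i x y \<noteq> 0"
  shows "association_scheme X D R \<and> second_eigenmatrix X D R Q"
proof -
  \<comment> \<open>The matrices are built from \<open>Q\<close> rather than \<open>e\<close>, since
    they have to vanish outside \<open>X \<times> X\<close>, where \<open>e\<close> is
    unconstrained; \<open>Ee\<close> shows that the two agree on \<open>X\<close>.\<close>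
  define E where "E = (\<lambda>j x y. 1 / real (card X) * (\<Sum>i\<le>D. Q $$ (i, j) * adjacency (R i) x y))"
  have cX: "card X > 0" using X by (simp add: card_gt_0_iff)
  have adj_sum: "(\<Sum>i\<le>D. c i * adjacency (R i) x y) = c k" if "k \<le> D" "(x, y) \<in> R k" for c k x y
    by (rule adjacency_partition_sum) (use disj that in auto)
  have Rsub: "R i \<subseteq> X \<times> X" if "i \<le> D" for i using union that by blast
  have rel: "\<exists>k\<le>D. (x, y) \<in> R k" if "x \<in> X" "y \<in> X" for x y using union that by blast
  have Ee: "E j x y = (if x \<in> X \<and> y \<in> X then e j x y else 0)" if j: "j \<le> D" for j x y
  proof (cases "x \<in> X \<and> y \<in> X")
    case True
    then obtain k where k: "k \<le> D" "(x, y) \<in> R k" using rel by blast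
    have "(\<Sum>i\<le>D. Q $$ (i, j) * adjacency (R i) x y) = Q $$ (k, j)"
      using adj_sum[OF k] by simp
    with eQ[OF k(1) j k(2)] cX True show ?thesis by (simp add: E_def field_simps)
  next
    case False
    then have "adjacency (R i) x y = 0" if "i \<le> D" for i
      using Rsub[OF that] by (auto simp: adjacency_def)
    then show ?thesis using False by (auto simp: E_def)
  qed
  interpret orthogonal_idempotents X D E
  proof
    fix i j assume ij: "i \<le> D" "j \<le> D"
    show "mat_prod_on X (E i) (E j) = (if i = j then E i else (\<lambda>x y. 0))"
    proof (intro ext)
      fix x y
      have "mat_prod_on X (E i) (E j) x y = (if x \<in> X \<and> y \<in> X then (\<Sum>z\<in>X. e i x z * e j z y) else 0)"
        unfolding mat_prod_on_def using ij by (auto simp: Ee)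
      then show "mat_prod_on X (E i) (E j) x y = (if i = j then E i else (\<lambda>x y. 0)) x y"
        using orth ij by (simp add: Ee)
    qed
  next
    fix i assume i: "i \<le> D"
    with nz[OF i] obtain x y where "x \<in> X" "y \<in> X" "e i x y \<noteq> 0" by blast
    then have "E i x y \<noteq> 0" using i by (simp add: Ee)
    then show "E i \<noteq> (\<lambda>x y. 0)" by auto
  qed
  \<comment> \<open>Change of basis: \<open>Q\<close>, divided by |X|, turns coordinates in the
    idempotents into coordinates in the adjacency matrices.\<close>
  have comb_alt: "comb c x y =
      (\<Sum>i\<le>D. (\<Sum>j\<le>D. Q $$ (i, j) * c j) / real (card X) * adjacency (R i) x y)" for c x y
    unfolding comb_def unfolding E_def sum_distrib_left sum_divide_distrib sum_distrib_right
    by (subst sum.swap) (simp add: algebra_simps)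
  have "det Q \<noteq> 0"
  proof
    assume "det Q = 0"
    then obtain v where v: "v \<in> carrier_vec (D + 1)" "v \<noteq> 0\<^sub>v (D + 1)" "Q *\<^sub>v v = 0\<^sub>v (D + 1)"
      using det_0_iff_vec_prod_zero_field[OF Q(1)] by blast
    have "(\<Sum>j\<le>D. Q $$ (i, j) * v $ j) = 0" if "i \<le> D" for i
    proof -
      have "(Q *\<^sub>v v) $ i = (\<Sum>j\<le>D. Q $$ (i, j) * v $ j)"
        using that Q(1) v(1) by (auto simp: scalar_prod_def atLeast0LessThan lessThan_Suc_atMost intro!: sum.cong)
      then show ?thesis using v(3) that by simp
    qed
    then have "comb (\<lambda>j. v $ j) = (\<lambda>x y. 0)" by (simp add: comb_alt fun_eq_iff)
    from comb_eq_0[OF this] have "v = 0\<^sub>v (D + 1)" using v(1) by (intro eq_vecI) auto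
    with v show False by simp
  qed
  from det_non_zero_imp_unit[OF Q(1) this] obtain P where
    P: "P \<in> carrier_mat (D + 1) (D + 1)" "Q * P = 1\<^sub>m (D + 1)" "P * Q = 1\<^sub>m (D + 1)"
    by (auto simp: Units_def ring_mat_def)
  have QP: "(\<Sum>j\<le>D. Q $$ (i, j) * P $$ (j, k)) = of_bool (i = k)" if "i \<le> D" "k \<le> D" for i k
  proof -
    have "(Q * P) $$ (i, k) = (\<Sum>j\<le>D. Q $$ (i, j) * P $$ (j, k))"
      using that P(1) Q(1) by (auto simp: scalar_prod_def atLeast0LessThan lessThan_Suc_atMost intro!: sum.cong)
    then show ?thesis using P(2) that by (auto simp: of_bool_def split: if_splits)
  qed
  \<comment> \<open>The inverse change of basis, with \<open>P\<close> the inverse of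
    \<open>Q\<close>.\<close>
  have A: "(\<lambda>x y. \<Sum>i\<le>D. c i * adjacency (R i) x y) =
      comb (\<lambda>j. real (card X) * (\<Sum>k\<le>D. P $$ (j, k) * c k))" for c
  proof (intro ext)
    fix x y
    have "(\<Sum>j\<le>D. Q $$ (i, j) * (real (card X) * (\<Sum>k\<le>D. P $$ (j, k) * c k))) = real (card X) * c i"
      if i: "i \<le> D" for i
    proof -
      have "(\<Sum>j\<le>D. Q $$ (i, j) * (real (card X) * (\<Sum>k\<le>D. P $$ (j, k) * c k)))
          = real (card X) * (\<Sum>k\<le>D. (\<Sum>j\<le>D. Q $$ (i, j) * P $$ (j, k)) * c k)"
        unfolding sum_distrib_left sum_distrib_right
        by (subst sum.swap) (simp add: algebra_simps)
      also have "(\<Sum>k\<le>D. (\<Sum>j\<le>D. Q $$ (i, j) * P $$ (j, k)) * c k) = (\<Sum>k\<le>D. if k = i then c k else 0)"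
        using i by (intro sum.cong) (auto simp: QP)
      finally show ?thesis using i by simp
    qed
    then show "(\<Sum>i\<le>D. c i * adjacency (R i) x y) =
        comb (\<lambda>j. real (card X) * (\<Sum>k\<le>D. P $$ (j, k) * c k)) x y"
      unfolding comb_alt using cX by (intro sum.cong) auto
  qed
  have bm_intro: "(\<lambda>x y. \<Sum>i\<le>D. c i * adjacency (R i) x y) \<in> bose_mesner D R" for c
    unfolding bose_mesner_def by (rule CollectI, rule exI[of _ c], rule refl)
  have bm: "bose_mesner D R = range comb"
  proof (intro equalityI subsetI)
    fix M assume "M \<in> bose_mesner D R"
    then obtain c where "M = (\<lambda>x y. \<Sum>i\<le>D. c i * adjacency (R i) x y)"
      unfolding bose_mesner_def by blast
    then show "M \<in> range comb" using A[of c] by simp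
  next
    fix M assume "M \<in> range comb"
    then obtain c where "M = comb c" by blast
    then have "M = (\<lambda>x y. \<Sum>i\<le>D. (\<Sum>j\<le>D. Q $$ (i, j) * c j) / real (card X) * adjacency (R i) x y)"
      by (simp add: fun_eq_iff comb_alt)
    then show "M \<in> bose_mesner D R" by (simp only: bm_intro)
  qed
  have adj_bm: "adjacency (R i) \<in> bose_mesner D R" if "i \<le> D" for i
  proof -
    have "adjacency (R i) = (\<lambda>x y. \<Sum>k\<le>D. of_bool (k = i) * adjacency (R k) x y)"
      using that by (simp add: fun_eq_iff sum.delta' if_distrib if_distribR of_bool_def cong: if_cong)
    also have "\<dots> \<in> bose_mesner D R" by (rule bm_intro)
    finally show ?thesis .
  qed
  have nonempty: "R i \<noteq> {}" if i: "i \<le> D" for i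
  proof
    assume "R i = {}"
    then have "(\<lambda>x y. \<Sum>k\<le>D. of_bool (k = i) * adjacency (R k) x y) = (\<lambda>x y. 0)"
      using i by (auto simp: fun_eq_iff adjacency_def intro!: sum.neutral)
    \<comment> \<open>A vanishing adjacency matrix has zero coordinates, so column \<open>i\<close>
      of \<open>P\<close> is zero, against \<open>Q * P = 1\<close>.\<close>
    from comb_eq_0[OF this[unfolded A]] have z: "P $$ (j, i) = 0" if "j \<le> D" for j
      using that i cX by (simp add: sum.delta' if_distrib of_bool_def cong: if_cong)
    have "(\<Sum>j\<le>D. Q $$ (i, j) * P $$ (j, i)) = 0" using z by simp
    then show False using QP[OF i i] by simp
  qed
  have inter: "\<exists>p. \<forall>(x, y)\<in>R k. card {z \<in> X. (x, z) \<in> R i \<and> (z, y) \<in> R j} = p"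
    if ijk: "i \<le> D" "j \<le> D" "k \<le> D" for i j k
  proof -
    obtain a b where ab: "adjacency (R i) = comb a" "adjacency (R j) = comb b"
      using adj_bm[OF ijk(1)] adj_bm[OF ijk(2)] unfolding bm by blast
    have "mat_prod_on X (adjacency (R i)) (adjacency (R j)) \<in> bose_mesner D R"
      unfolding ab prod_comb bm by blast
    then obtain c where c: "mat_prod_on X (adjacency (R i)) (adjacency (R j)) = (\<lambda>x y. \<Sum>k\<le>D. c k * adjacency (R k) x y)"
      unfolding bose_mesner_def by blast
    \<comment> \<open>The coefficient \<open>c k\<close> counts points, so it is a natural number;
      the floor names that number without reference to the pair.\<close>
    have "card {z \<in> X. (x, z) \<in> R i \<and> (z, y) \<in> R j} = nat \<lfloor>c k\<rfloor>" if xy: "(x, y) \<in> R k" for x y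
    proof -
      have "mat_prod_on X (adjacency (R i)) (adjacency (R j)) x y =
          (\<Sum>z\<in>X. if (x, z) \<in> R i \<and> (z, y) \<in> R j then 1 else 0)"
        unfolding mat_prod_on_def adjacency_def by (intro sum.cong) auto
      also have "\<dots> = real (card {z \<in> X. (x, z) \<in> R i \<and> (z, y) \<in> R j})"
        using X by (simp add: sum.If_cases Int_def)
      finally have "real (card {z \<in> X. (x, z) \<in> R i \<and> (z, y) \<in> R j}) = c k"
        unfolding c using adj_sum[OF \<open>k \<le> D\<close> xy] by simp
      then show ?thesis by (metis floor_of_nat nat_int)
    qed
    then show ?thesis by blast
  qed
  have "association_scheme X D R"
    unfolding association_scheme_def
    by (intro conjI allI impI X R0 sym disj union nonempty inter)
  moreover have "E 0 = (\<lambda>x y. 1 / real (card X) * adjacency (X \<times> X) x y)"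
  proof (intro ext)
    fix x y
    show "E 0 x y = 1 / real (card X) * adjacency (X \<times> X) x y"
    proof (cases "x \<in> X \<and> y \<in> X")
      case True
      then obtain k where k: "k \<le> D" "(x, y) \<in> R k" using rel by blast
      have "real (card X) * e 0 x y = 1" using eQ[OF k(1) _ k(2)] Q(2) k by simp
      then show ?thesis using True cX by (simp add: Ee adjacency_def field_simps)
    qed (auto simp: Ee adjacency_def)
  qed
  then have "second_eigenmatrix X D R Q"
    unfolding second_eigenmatrix_def
    using Q(1) primitive_idempotents_eq[OF bm] inj_idempotents
    by (intro conjI exI[of _ E] allI impI) (simp_all add: bij_betw_def, simp add: E_def)
  ultimately show ?thesis ..
qed

section \<open>Orthogonal kernels on designs\<close>

lemma words_Suc: "words q (Suc n) = (\<lambda>(a, w). a # w) ` ({1..q} \<times> words q n)"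
proof (intro equalityI subsetI)
  fix x assume "x \<in> words q (Suc n)"
  then show "x \<in> (\<lambda>(a, w). a # w) ` ({1..q} \<times> words q n)"
    by (cases x) (auto simp: words_def)
qed (auto simp: words_def)

lemma finite_words: "finite (words q n)"
  using finite_lists_length_eq[of "{1..q}" n] by (simp add: words_def conj_commute)

lemma nth_words: "x \<in> words q n \<Longrightarrow> k < n \<Longrightarrow> x ! k \<in> {1..q}"
  unfolding words_def using nth_mem[of k x] by blast

lemma sum_words_prod:
  fixes h :: "nat \<Rightarrow> nat \<Rightarrow> real"
  shows "(\<Sum>w\<in>words q t. \<Prod>i<t. h i (w ! i)) = (\<Prod>i<t. \<Sum>a\<in>{1..q}. h i a)"
proof (induction t arbitrary: h)
  case 0
  have "words q 0 = {[]}" by (auto simp: words_def)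
  then show ?case by simp
next
  case (Suc t)
  have "(\<Sum>w\<in>words q (Suc t). \<Prod>i<Suc t. h i (w ! i)) =
      (\<Sum>(a, w)\<in>{1..q} \<times> words q t. h 0 a * (\<Prod>i<t. h (Suc i) (w ! i)))"
    unfolding words_Suc
    by (subst sum.reindex) (auto simp: inj_on_def prod.lessThan_Suc_shift case_prod_unfold simp del: prod.lessThan_Suc)
  also have "\<dots> = (\<Sum>a\<in>{1..q}. h 0 a) * (\<Sum>w\<in>words q t. \<Prod>i<t. h (Suc i) (w ! i))"
    by (simp add: sum.cartesian_product[symmetric] sum_product)
  also have "\<dots> = (\<Prod>i<Suc t. \<Sum>a\<in>{1..q}. h i a)"
    unfolding Suc.IH[of "\<lambda>i. h (Suc i)"] by (simp add: prod.lessThan_Suc_shift del: prod.lessThan_Suc One_nat_def)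
  finally show ?case .
qed

lemma nths_eq_map_filter: "nths x S = map ((!) x) (filter (\<lambda>k. k \<in> S) [0..<length x])"
proof -
  have "zip x [0..<length x] = map (\<lambda>k. (x ! k, k)) [0..<length x]"
    by (rule nth_equalityI) auto
  then show ?thesis by (simp add: nths_def filter_map o_def)
qed

text \<open>Codewords are grouped by their restriction to \<open>S\<close>. Every word of length
  \<open>t\<close> arises \<open>l\<close> times, so the sum is \<open>l\<close> times a sum over
  all words, which factors by \<open>sum_words_prod\<close>; the constant function 1 determines
  \<open>l\<close>.\<close>

lemma design_sum_prod_eq:
  fixes g :: "nat \<Rightarrow> nat \<Rightarrow> real"
  assumes "hamming_design n q t C" and "q > 0" and S: "S \<subseteq> {..<n}" "card S = t"
  shows "(\<Sum>y\<in>C. \<Prod>k\<in>S. g k (y ! k)) = real (card C) * (\<Prod>k\<in>S. (\<Sum>a\<in>{1..q}. g k a) / real q)"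
proof -
  from assms have C: "C \<subseteq> words q n"
    and "\<exists>l. \<forall>w\<in>words q t. card {x \<in> C. nths x S = w} = l"
    by (auto simp: hamming_design_def)
  then obtain l where l: "\<And>w. w \<in> words q t \<Longrightarrow> card {x \<in> C. nths x S = w} = l" by blast
  have finC: "finite C" using C finite_words finite_subset by blast
  define ks where "ks = filter (\<lambda>k. k \<in> S) [0..<n]"
  have ks: "distinct ks" "set ks = S" using S by (auto simp: ks_def)
  then have lks: "length ks = t" using S distinct_card by metis
  have bij: "bij_betw ((!) ks) {..<t} S" using bij_betw_nth[OF ks(1)] ks(2) lks by blast
  have nths: "nths y S = map ((!) y) ks" if "y \<in> C" for y
    using that C by (auto simp: nths_eq_map_filter ks_def words_def)
  have img: "(\<lambda>y. nths y S) ` C \<subseteq> words q t"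
  proof safe
    fix y assume y: "y \<in> C"
    have "y ! k \<in> {1..q}" if "k \<in> S" for k using nth_words[of y q n k] y C S that by blast
    then show "nths y S \<in> words q t" using nths[OF y] ks lks by (auto simp: words_def)
  qed
  have *: "(\<Sum>y\<in>C. \<Prod>k\<in>S. g k (y ! k)) = real l * (\<Prod>k\<in>S. \<Sum>a\<in>{1..q}. g k a)" for g :: "nat \<Rightarrow> nat \<Rightarrow> real"
  proof -
    define f where "f = (\<lambda>w::nat list. \<Prod>i<t. g (ks ! i) (w ! i))"
    have "(\<Prod>k\<in>S. g k (y ! k)) = f (nths y S)" if "y \<in> C" for y
      unfolding f_def prod.reindex_bij_betw[OF bij, symmetric] nths[OF that]
      using lks by (intro prod.cong) auto
    then have "(\<Sum>y\<in>C. \<Prod>k\<in>S. g k (y ! k)) = (\<Sum>y\<in>C. f (nths y S))" by simp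
    also have "\<dots> = (\<Sum>w\<in>words q t. \<Sum>y\<in>{y \<in> C. nths y S = w}. f (nths y S))"
      using sum.group[OF finC finite_words img, of "\<lambda>y. f (nths y S)"] by simp
    also have "\<dots> = (\<Sum>w\<in>words q t. real l * f w)"
      using l by (intro sum.cong) auto
    also have "\<dots> = real l * (\<Prod>i<t. \<Sum>a\<in>{1..q}. g (ks ! i) a)"
      by (simp add: f_def sum_words_prod[of "\<lambda>i. g (ks ! i)"] sum_distrib_left[symmetric] del: One_nat_def)
    also have "(\<Prod>i<t. \<Sum>a\<in>{1..q}. g (ks ! i) a) = (\<Prod>k\<in>S. \<Sum>a\<in>{1..q}. g k a)"
      by (rule prod.reindex_bij_betw[OF bij])
    finally show ?thesis .
  qed
  have "real (card C) = real l * real q ^ t"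
    using *[of "\<lambda>_ _. 1"] S by simp
  then show ?thesis using * S assms(2) by (simp add: prod_dividef)
qed

text \<open>Pads \<open>K\<close> to exactly \<open>t\<close> coordinates, which exist since
  \<open>t \<le> n\<close>; the added factors are constantly 1, and so is their mean over the
  letters.\<close>

lemma design_sum_prod:
  fixes g :: "nat \<Rightarrow> nat \<Rightarrow> real"
  assumes d: "hamming_design n q t C" and q: "q > 0" and K: "K \<subseteq> {..<n}" "card K \<le> t"
  shows "(\<Sum>y\<in>C. \<Prod>k\<in>K. g k (y ! k)) = real (card C) * (\<Prod>k\<in>K. (\<Sum>a\<in>{1..q}. g k a) / real q)"
proof -
  have "t \<le> n" using d by (simp add: hamming_design_def)
  then obtain S where S: "K \<subseteq> S" "S \<subseteq> {..<n}" "card S = t"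
    using exists_subset_between[of K t "{..<n}"] K by auto
  have finS: "finite S" using S finite_subset by blast
  define g' where "g' = (\<lambda>k a. if k \<in> K then g k a else 1)"
  have "(\<Prod>k\<in>K. g k (y ! k)) = (\<Prod>k\<in>S. g' k (y ! k))" for y
    by (rule prod.mono_neutral_cong_left) (use S finS in \<open>auto simp: g'_def\<close>)
  moreover have "(\<Prod>k\<in>K. (\<Sum>a\<in>{1..q}. g k a) / real q) = (\<Prod>k\<in>S. (\<Sum>a\<in>{1..q}. g' k a) / real q)"
    by (rule prod.mono_neutral_cong_left) (use S finS q in \<open>auto simp: g'_def\<close>)
  ultimately show ?thesis using design_sum_prod_eq[OF d q S(2,3), of g'] by simp
qed

text \<open>A real substitute for the sum of the characters of \<open>(\<int>/q)\<^sup>n\<close> with support \<open>S\<close>, evaluated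
  at \<open>x - y\<close>.\<close>

definition support_kernel :: "nat \<Rightarrow> nat set \<Rightarrow> nat list \<Rightarrow> nat list \<Rightarrow> real" where
  "support_kernel q S x y = (\<Prod>k\<in>S. real q * of_bool (x ! k = y ! k) - 1)"

text \<open>The product of the two kernels factors over the coordinates in
  \<open>S \<union> S'\<close>, so \<open>design_sum_prod\<close> reduces the sum to means of single
  factors. A coordinate in only one of the sets has mean zero by \<open>f1\<close>; a coordinate in
  both reproduces its factor by \<open>f2\<close>.\<close>

lemma support_kernel_orthogonal:
  assumes d: "hamming_design n q t C" and q: "q > 0"
    and S: "S \<subseteq> {..<n}" "S' \<subseteq> {..<n}" "card (S \<union> S') \<le> t"
    and x: "x \<in> words q n" and y: "y \<in> words q n"
  shows "(\<Sum>z\<in>C. support_kernel q S x z * support_kernel q S' z y) = (if S = S' then real (card C) * support_kernel q S x y else 0)"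
proof -
  define f where "f = (\<lambda>a b::nat. real q * of_bool (a = b) - 1)"
  define g where "g = (\<lambda>k a. (if k \<in> S then f (x ! k) a else 1) * (if k \<in> S' then f a (y ! k) else 1))"
  have fin: "finite S" "finite S'" using S finite_subset by blast+
  have pt: "support_kernel q S x z * support_kernel q S' z y = (\<Prod>k\<in>S \<union> S'. g k (z ! k))" for z
  proof -
    have "support_kernel q S x z = (\<Prod>k\<in>S \<union> S'. if k \<in> S then f (x ! k) (z ! k) else 1)"
      unfolding support_kernel_def f_def by (rule prod.mono_neutral_cong_left) (use fin in auto)
    moreover have "support_kernel q S' z y = (\<Prod>k\<in>S \<union> S'. if k \<in> S' then f (z ! k) (y ! k) else 1)"
      unfolding support_kernel_def f_def by (rule prod.mono_neutral_cong_left) (use fin in auto)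
    ultimately show ?thesis by (simp add: g_def prod.distrib)
  qed
  have f1: "(\<Sum>a\<in>{1..q}. f b a) = 0" "(\<Sum>a\<in>{1..q}. f a b) = 0" if "b \<in> {1..q}" for b
    using that by (simp_all add: f_def sum_subtractf sum_distrib_left[symmetric])
  \<comment> \<open>As a matrix on the letters, \<open>f\<close> is q I - J, whose square is q times
    itself.\<close>
  have f2: "(\<Sum>a\<in>{1..q}. f b a * f a c) = real q * f b c" if bc: "b \<in> {1..q}" "c \<in> {1..q}" for b c
  proof -
    have "f b a * f a c = real q * (if a = b then f b c else 0) - f a c" for a
      by (auto simp: f_def algebra_simps)
    then have "(\<Sum>a\<in>{1..q}. f b a * f a c) = real q * (\<Sum>a\<in>{1..q}. if a = b then f b c else 0) - (\<Sum>a\<in>{1..q}. f a c)"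
      by (simp only: sum_subtractf sum_distrib_left)
    then show ?thesis using f1(2)[OF bc(2)] bc(1) by simp
  qed
  have xy: "x ! k \<in> {1..q}" "y ! k \<in> {1..q}" if "k \<in> S \<union> S'" for k
    using nth_words x y S that by blast+
  have "(\<Sum>z\<in>C. support_kernel q S x z * support_kernel q S' z y) =
      real (card C) * (\<Prod>k\<in>S \<union> S'. (\<Sum>a\<in>{1..q}. g k a) / real q)"
    unfolding pt using design_sum_prod[OF d q _ S(3), of g] S by auto
  also have "(\<Prod>k\<in>S \<union> S'. (\<Sum>a\<in>{1..q}. g k a) / real q) = (if S = S' then support_kernel q S x y else 0)"
  proof (cases "S = S'")
    case True
    then have "(\<Sum>a\<in>{1..q}. g k a) / real q = f (x ! k) (y ! k)" if "k \<in> S" for k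
      using f2[OF xy[of k]] that q by (simp add: g_def)
    then show ?thesis using True by (simp add: support_kernel_def f_def)
  next
    case False
    then obtain k where k: "k \<in> S \<union> S'" "k \<notin> S \<inter> S'" by blast
    then have "(\<Sum>a\<in>{1..q}. g k a) = 0"
      using f1(1)[OF xy(1)[OF k(1)]] f1(2)[OF xy(2)[OF k(1)]] by (cases "k \<in> S") (auto simp: g_def)
    then have "(\<Prod>k\<in>S \<union> S'. (\<Sum>a\<in>{1..q}. g k a) / real q) = 0"
      using k(1) fin by (intro prod_zero) auto
    then show ?thesis using False by simp
  qed
  finally show ?thesis by simp
qed

text \<open>Let \<open>N\<close> be the set of coordinates in \<open>K\<close> where
  \<open>x\<close> and \<open>y\<close> differ. Each element of \<open>S\<close> contributes -1 in
  \<open>N\<close> and q - 1 outside, so sorting the sets \<open>S\<close> by the size of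
  \<open>S \<inter> N\<close> gives the Krawtchouk sum term by term.\<close>

lemma sum_support_kernel_eq_krawtchouk:
  assumes "finite K"
  shows "(\<Sum>S | S \<subseteq> K \<and> card S = j. support_kernel q S x y) =
    krawtchouk (card K) q j (real (card {k \<in> K. x ! k \<noteq> y ! k}))"
proof -
  define N where "N = {k \<in> K. x ! k \<noteq> y ! k}"
  define subs where "subs = (\<lambda>(A::nat set) l. {S. S \<subseteq> A \<and> card S = l})"
  have fin: "finite N" "finite (K - N)" "N \<subseteq> K" using assms by (auto simp: N_def)
  have fsub: "finite A \<Longrightarrow> finite (subs A l)" for A l by (simp add: subs_def)
  have val: "support_kernel q (A \<union> B) x y = (-1) ^ card A * (real q - 1) ^ card B"
    if "A \<subseteq> N" "B \<subseteq> K - N" for A B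
  proof -
    have fAB: "finite A" "finite B" using that fin finite_subset by blast+
    have "support_kernel q (A \<union> B) x y = (\<Prod>k\<in>A. real q * of_bool (x ! k = y ! k) - 1) * (\<Prod>k\<in>B. real q * of_bool (x ! k = y ! k) - 1)"
      unfolding support_kernel_def by (rule prod.union_disjoint) (use that fAB in auto)
    also have "(\<Prod>k\<in>A. real q * of_bool (x ! k = y ! k) - 1) = (\<Prod>k\<in>A. -1)"
      by (rule prod.cong) (use that in \<open>auto simp: N_def\<close>)
    also have "(\<Prod>k\<in>B. real q * of_bool (x ! k = y ! k) - 1) = (\<Prod>k\<in>B. real q - 1)"
      by (rule prod.cong) (use that in \<open>auto simp: N_def\<close>)
    finally show ?thesis by simp
  qed
  have "(\<Sum>S\<in>subs K j. support_kernel q S x y) = (\<Sum>(l, A, B)\<in>(SIGMA l:{0..j}. subs N l \<times> subs (K - N) (j - l)). support_kernel q (A \<union> B) x y)"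
  proof (rule sum.reindex_bij_witness[of _ "\<lambda>(l, A, B). A \<union> B" "\<lambda>S. (card (S \<inter> N), S \<inter> N, S - N)"])
    fix S assume S: "S \<in> subs K j"
    then have "finite S" using assms finite_subset by (auto simp: subs_def)
    then have c: "card S = card (S \<inter> N) + card (S - N)"
      by (metis Int_Diff_Un Int_Diff_disjoint card_Un_disjoint finite_Diff finite_Int)
    show "(\<lambda>(l, A, B). A \<union> B) (card (S \<inter> N), S \<inter> N, S - N) = S" by auto
    show "(card (S \<inter> N), S \<inter> N, S - N) \<in> (SIGMA l:{0..j}. subs N l \<times> subs (K - N) (j - l))"
      using S c by (auto simp: subs_def)
    show "(case (card (S \<inter> N), S \<inter> N, S - N) of (l, A, B) \<Rightarrow> support_kernel q (A \<union> B) x y) = support_kernel q S x y"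
      by (simp add: Int_Diff_Un)
  next
    fix p assume "p \<in> (SIGMA l:{0..j}. subs N l \<times> subs (K - N) (j - l))"
    then obtain l A B where p: "p = (l, A, B)" "l \<le> j" "A \<subseteq> N" "card A = l" "B \<subseteq> K - N" "card B = j - l"
      by (auto simp: subs_def)
    then have fAB: "finite A" "finite B" using fin finite_subset by blast+
    have "(A \<union> B) \<inter> N = A" "(A \<union> B) - N = B" "A \<inter> B = {}" using p by auto
    then show "(\<lambda>S. (card (S \<inter> N), S \<inter> N, S - N)) ((\<lambda>(l, A, B). A \<union> B) p) = p"
      "(\<lambda>(l, A, B). A \<union> B) p \<in> subs K j"
      using p fin fAB by (auto simp: subs_def card_Un_disjoint)
  qed
  also have "\<dots> = (\<Sum>l=0..j. \<Sum>(A, B)\<in>subs N l \<times> subs (K - N) (j - l). support_kernel q (A \<union> B) x y)"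
    using fin by (subst sum.Sigma) (auto simp: fsub)
  also have "\<dots> = (\<Sum>l=0..j. \<Sum>(A, B)\<in>subs N l \<times> subs (K - N) (j - l). (-1) ^ l * (real q - 1) ^ (j - l))"
    by (intro sum.cong refl) (auto simp: subs_def val)
  also have "\<dots> = (\<Sum>l=0..j. real ((card N choose l) * (card (K - N) choose (j - l))) * ((-1) ^ l * (real q - 1) ^ (j - l)))"
    using fin by (simp add: subs_def case_prod_unfold card_cartesian_product n_subsets)
  also have "\<dots> = krawtchouk (card K) q j (real (card N))"
  proof -
    have "card N \<le> card K" using fin assms card_mono by blast
    then have "real (card K) - real (card N) = real (card (K - N))"
      using fin by (simp add: card_Diff_subset of_nat_diff)
    then show ?thesis
      unfolding krawtchouk_def by (intro sum.cong) (simp_all add: binomial_gbinomial)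
  qed
  finally show ?thesis by (simp add: subs_def N_def)
qed

section \<open>Krawtchouk polynomials\<close>

lemma gchoose_polynomial:
  "\<exists>p :: real poly. degree p \<le> l \<and> (\<forall>x. poly p x = x gchoose l)"
proof (intro exI[of _ "smult (1 / fact l) (\<Prod>i<l. [:- real i, 1:])"] conjI allI)
  have "degree (\<Prod>i<l. [:- real i, 1:]) \<le> (\<Sum>i<l. degree [:- real i, 1:])"
    using degree_prod_sum_le[of "{..<l}" "\<lambda>i. [:- real i, 1:]"] by (simp add: o_def)
  then show "degree (smult (1 / fact l) (\<Prod>i<l. [:- real i, 1:])) \<le> l" by simp
  show "poly (smult (1 / fact l) (\<Prod>i<l. [:- real i, 1:])) x = x gchoose l" for x
    by (simp add: poly_prod gbinomial_prod_rev atLeast0LessThan)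
qed

text \<open>The degree bound is what counts: it limits the number of roots in
  \<open>tight_degree_missing\<close>.\<close>

lemma krawtchouk_polynomial:
  "\<exists>p. degree p \<le> j \<and> (\<forall>x. poly p x = krawtchouk m q j x)"
proof -
  obtain b :: "nat \<Rightarrow> real poly" where b: "\<And>l. degree (b l) \<le> l" "\<And>l x. poly (b l) x = x gchoose l"
    using gchoose_polynomial by metis
  define p where "p = (\<Sum>l=0..j. smult ((-1) ^ l * (real q - 1) ^ (j - l))
     (b l * pcompose (b (j - l)) [:real m, -1:]))"
  have "degree (b l * pcompose (b (j - l)) [:real m, -1:]) \<le> j" if "l \<le> j" for l
  proof -
    have "degree (pcompose (b (j - l)) [:real m, -1:]) \<le> j - l"
      using b(1)[of "j - l"] degree_pcompose_le[of "b (j - l)" "[:real m, -1:]"] by simp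
    then show ?thesis
      using degree_mult_le[of "b l" "pcompose (b (j - l)) [:real m, -1:]"] b(1)[of l] that by linarith
  qed
  then have "degree p \<le> j" unfolding p_def
    by (intro degree_sum_le) (auto intro!: order.trans[OF degree_smult_le])
  moreover have "poly p x = krawtchouk m q j x" for x
    by (simp add: p_def krawtchouk_def poly_sum poly_pcompose b mult.assoc)
  ultimately show ?thesis by blast
qed

lemma krawtchouk_0: "krawtchouk m q j 0 = (real q - 1) ^ j * real (m choose j)"
proof -
  have "krawtchouk m q j 0 = (\<Sum>l=0..j. if l = 0 then (real q - 1) ^ j * real (m choose j) else 0)"
    unfolding krawtchouk_def
    by (intro sum.cong) (auto simp: binomial_gbinomial gbinomial_0_left)
  then show ?thesis by simp
qed

text \<open>Recasts the size of a tight design in the form in which it appears on the diagonal of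
  \<open>rest\<close>. Pascal's rule drives the induction.\<close>

lemma tight_bound_eq:
  assumes "s \<ge> 1" "n \<ge> 1" "q \<ge> 1"
  shows "real ((\<Sum>k = 0..s - 1. (n choose k) * (q - 1) ^ k) + ((n - 1) choose (s - 1)) * (q - 1) ^ s)
    = real q * (\<Sum>l<s. krawtchouk (n - 1) q l 0)"
proof -
  obtain m where n: "n = Suc m" using assms by (cases n) auto
  \<comment> \<open>Here \<open>r\<close> stands for \<open>s - 1\<close>, so the induction starts
    at \<open>s = 1\<close>.\<close>
  have "real (\<Sum>k = 0..r. (n choose k) * (q - 1) ^ k) + real (m choose r) * (real q - 1) ^ Suc r
     = real q * (\<Sum>l\<le>r. (real q - 1) ^ l * real (m choose l))" for r
  proof (induction r)
    case (Suc r)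
    moreover have "real (\<Sum>k = 0..Suc r. (n choose k) * (q - 1) ^ k) =
        real (\<Sum>k = 0..r. (n choose k) * (q - 1) ^ k) +
        (real (m choose r) + real (m choose Suc r)) * (real q - 1) ^ Suc r"
      using assms(3) by (simp add: n of_nat_diff)
    ultimately show ?case by (simp add: algebra_simps)
  qed (use assms in \<open>simp add: n\<close>)
  from this[of "s - 1"] show ?thesis
    using assms by (simp add: n krawtchouk_0 of_nat_diff lessThan_Suc_atMost[symmetric])
qed

section \<open>Designs of odd strength split by the first coordinate\<close>

lemma sum_of_bool_mult:
  fixes f :: "'a \<Rightarrow> real"
  assumes "finite X" "a \<in> X"
  shows "(\<Sum>z\<in>X. f z * of_bool (z = a)) = f a" "(\<Sum>z\<in>X. of_bool (a = z) * f z) = f a"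
proof -
  have "(\<Sum>z\<in>X. f z * of_bool (z = a)) = (\<Sum>z\<in>X. if z = a then f a else 0)"
    by (intro sum.cong) auto
  then show "(\<Sum>z\<in>X. f z * of_bool (z = a)) = f a" using assms by simp
  have "(\<Sum>z\<in>X. of_bool (a = z) * f z) = (\<Sum>z\<in>X. if z = a then f a else 0)"
    by (intro sum.cong) auto
  then show "(\<Sum>z\<in>X. of_bool (a = z) * f z) = f a" using assms by simp
qed

locale odd_design =
  fixes n q s :: nat and C :: "nat list set" and \<alpha> :: "nat \<Rightarrow> nat"
  assumes n: "n \<ge> 2" and q: "q \<ge> 2" and s: "s \<ge> 1"
    and design: "hamming_design n q (2 * s - 1) C"
    and degrees: "degree_set C = \<alpha> ` {1..s}"
    and mono: "strict_mono_on {1..s} \<alpha>" and \<alpha>0: "\<alpha> 0 = 0"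
begin

abbreviation X where "X \<equiv> block_union q C"

section \<open>Points of the blocks as codewords, distances and degrees\<close>

definition word :: "nat \<times> nat list \<Rightarrow> nat list" where "word p = fst p # snd p"

text \<open>Between blocks this is one less than the distance of the codewords; inside a block the
  two agree.\<close>

definition dist where "dist p p' = hamming_dist (snd p) (snd p')"

text \<open>The factor of \<open>support_kernel\<close> at coordinate 0: q - 1 inside a block and -1
  between blocks.\<close>

definition balance :: "nat \<times> nat list \<Rightarrow> nat \<times> nat list \<Rightarrow> real" where
  "balance p p' = real q * of_bool (fst p = fst p') - 1"

definition kr where "kr j p p' = krawtchouk (n - 1) q j (real (dist p p'))"

text \<open>\<open>False\<close> refers to supports that avoid the first coordinate and
  \<open>True\<close> to those that contain it; \<open>idem_kernel\<close> makes this
  precise.\<close>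

definition idem :: "bool \<Rightarrow> nat \<Rightarrow> nat \<times> nat list \<Rightarrow> nat \<times> nat list \<Rightarrow> real" where
  "idem b j p p' = (if b then balance p p' else 1) * kr j p p' / real (card C)"

definition rest :: "nat \<times> nat list \<Rightarrow> nat \<times> nat list \<Rightarrow> real" where
  "rest p p' = of_bool (p = p') - (\<Sum>j<s. idem False j p p' + idem True j p p')"

lemma C_words: "C \<subseteq> words q n" and C_nonempty: "C \<noteq> {}" and strength: "2 * s - 1 \<le> n"
  using design by (auto simp: hamming_design_def)

lemma finite_C: "finite C"
  using C_words finite_words finite_subset by blast

lemma card_C: "card C > 0"
  using finite_C C_nonempty by (simp add: card_gt_0_iff)

lemma word_in: "p \<in> X \<Longrightarrow> word p \<in> C"
  by (auto simp: block_union_def code_block_def word_def)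

lemma bij_word: "bij_betw word X C"
proof (rule bij_betw_byWitness[where f' = "\<lambda>x. (hd x, tl x)"])
  show "(\<lambda>x. (hd x, tl x)) ` C \<subseteq> X"
  proof safe
    fix x assume x: "x \<in> C"
    then have "x \<in> words q n" using C_words by blast
    then show "(hd x, tl x) \<in> X" using x n
      by (cases x) (auto simp: words_def block_union_def code_block_def)
  qed
  show "\<forall>x\<in>C. word (hd x, tl x) = x"
  proof
    fix x assume "x \<in> C"
    then have "x \<noteq> []" using C_words n by (auto simp: words_def)
    then show "word (hd x, tl x) = x" by (simp add: word_def)
  qed
qed (use word_in in \<open>auto simp: word_def\<close>)

lemma finite_X: "finite X" and card_X: "card X = card C" and X_nonempty: "X \<noteq> {}"
  using bij_betw_finite[OF bij_word] finite_C bij_betw_same_card[OF bij_word] card_C by auto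

lemma sum_X: "(\<Sum>z\<in>X. f (word z)) = (\<Sum>y\<in>C. f y)"
  by (rule sum.reindex_bij_betw[OF bij_word])

lemma word_words: "p \<in> X \<Longrightarrow> word p \<in> words q n"
  using word_in C_words by blast

lemma length_snd: "p \<in> X \<Longrightarrow> length (snd p) = n - 1"
  using word_words[of p] by (auto simp: words_def word_def)

lemma hamming_dist_eq_0:
  "length x = length y \<Longrightarrow> hamming_dist x y = 0 \<longleftrightarrow> x = y"
  by (auto simp: hamming_dist_def list_eq_iff_nth_eq)

lemma dist_alt:
  assumes "p \<in> X" "p' \<in> X"
  shows "dist p p' = card {k \<in> {1..<n}. word p ! k \<noteq> word p' ! k}"
proof -
  have "{k \<in> {1..<n}. word p ! k \<noteq> word p' ! k} = Suc ` {k. k < length (snd p) \<and> snd p ! k \<noteq> snd p' ! k}"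
  proof (intro equalityI subsetI)
    fix k assume "k \<in> {k \<in> {1..<n}. word p ! k \<noteq> word p' ! k}"
    then show "k \<in> Suc ` {k. k < length (snd p) \<and> snd p ! k \<noteq> snd p' ! k}"
      using length_snd[OF assms(1)] by (cases k) (auto simp: word_def)
  qed (use length_snd[OF assms(1)] in \<open>auto simp: word_def\<close>)
  then show ?thesis by (simp add: dist_def hamming_dist_def card_image)
qed

lemma dist_0: "p \<in> X \<Longrightarrow> p' \<in> X \<Longrightarrow> fst p = fst p' \<Longrightarrow> dist p p' = 0 \<longleftrightarrow> p = p'"
  using hamming_dist_eq_0[of "snd p" "snd p'"] length_snd by (auto simp: dist_def prod_eq_iff)

lemma dist_sym: "p \<in> X \<Longrightarrow> p' \<in> X \<Longrightarrow> dist p p' = dist p' p"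
  unfolding dist_alt by (rule arg_cong[where f = card]) auto

lemma hamming_dist_Cons: "hamming_dist (a # x) (b # y) = of_bool (a \<noteq> b) + hamming_dist x y"
proof -
  have *: "{k. k < length (a # x) \<and> (a # x) ! k \<noteq> (b # y) ! k} =
      (if a \<noteq> b then {0} else {}) \<union> Suc ` {k. k < length x \<and> x ! k \<noteq> y ! k}" (is "?L = ?R")
  proof (intro equalityI subsetI)
    fix k assume "k \<in> ?L"
    then show "k \<in> ?R" by (cases k) auto
  qed (auto split: if_splits)
  show ?thesis unfolding hamming_dist_def * by (subst card_Un_disjoint) (auto simp: card_image)
qed

lemma dist_degree:
  assumes "p \<in> X" "p' \<in> X" "p \<noteq> p'"
  shows "of_bool (fst p \<noteq> fst p') + dist p p' \<in> \<alpha> ` {1..s}"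
proof -
  have "word p \<noteq> word p'" using assms by (auto simp: word_def prod_eq_iff)
  then have "hamming_dist (word p) (word p') \<in> degree_set C"
    using word_in[OF assms(1)] word_in[OF assms(2)] unfolding degree_set_def by blast
  then show ?thesis unfolding degrees by (simp add: word_def hamming_dist_Cons dist_def)
qed

text \<open>Separates \<alpha> 0 from the degrees, and makes the truncated difference \<alpha> i - 1
  agree with the real one.\<close>

lemma \<alpha>_pos: "i \<in> {1..s} \<Longrightarrow> \<alpha> i \<ge> 1"
proof -
  assume "i \<in> {1..s}"
  then have "\<alpha> i \<in> degree_set C" using degrees by blast
  then obtain x y where "x \<in> C" "y \<in> C" "x \<noteq> y" "\<alpha> i = hamming_dist x y"
    by (auto simp: degree_set_def)
  moreover from this have "length x = length y" using C_words by (auto simp: words_def)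
  ultimately show ?thesis using hamming_dist_eq_0[of x y] by simp
qed

lemma \<alpha>_inj:
  assumes "i \<le> s" "j \<le> s" "\<alpha> i = \<alpha> j" shows "i = j"
proof -
  have "i = 0 \<longleftrightarrow> j = 0"
    using \<alpha>_pos[of i] \<alpha>_pos[of j] \<alpha>0 assms by fastforce
  moreover have "i = j" if "i \<in> {1..s}" "j \<in> {1..s}"
    using inj_onD[OF strict_mono_on_imp_inj_on[OF mono] assms(3) that] .
  ultimately show ?thesis using assms by fastforce
qed

lemma \<alpha>_le: "i \<in> {1..s} \<Longrightarrow> \<alpha> i \<le> \<alpha> s"
  using strict_mono_onD[OF mono, of i s] s by (cases "i = s") auto

section \<open>Orthogonality of the idempotents\<close>

text \<open>Only coordinates of the tails are counted by \<open>j\<close>; with \<open>b\<close>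
  true the sets have j + 1 elements.\<close>

definition supports :: "bool \<Rightarrow> nat \<Rightarrow> nat set set" where
  "supports b j = (\<lambda>S. if b then insert 0 S else S) ` {S. S \<subseteq> {1..<n} \<and> card S = j}"

lemma supports_sub: "S \<in> supports b j \<Longrightarrow> S \<subseteq> {..<n}"
  using n by (auto simp: supports_def split: if_splits)

lemma finite_supports: "finite (supports b j)"
  by (simp add: supports_def)

lemma supports_disjoint:
  assumes "S \<in> supports b i" "S \<in> supports b' j" shows "b = b' \<and> i = j"
proof -
  obtain A where A: "A \<subseteq> {1..<n}" "card A = i" "S = (if b then insert 0 A else A)"
    using assms(1) unfolding supports_def by blast
  obtain B where B: "B \<subseteq> {1..<n}" "card B = j" "S = (if b' then insert 0 B else B)"
    using assms(2) unfolding supports_def by blast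
  have "0 \<notin> A" "0 \<notin> B" using A(1) B(1) by auto
  then have "b = b'" "A = B" using A(3) B(3) insert_ident[of 0 A B] by (auto split: if_splits)
  then show ?thesis using A B by simp
qed

text \<open>The first coordinate counts once and each set has at most s - 1 others, so the union has
  at most 1 + 2 (s - 1) elements, which is exactly the strength of the design.\<close>

lemma supports_card:
  assumes "S \<in> supports b i" "S' \<in> supports b' j" "i < s" "j < s"
  shows "card (S \<union> S') \<le> 2 * s - 1"
proof -
  obtain A where A: "A \<subseteq> {1..<n}" "card A = i" "S = (if b then insert 0 A else A)"
    using assms(1) unfolding supports_def by blast
  obtain B where B: "B \<subseteq> {1..<n}" "card B = j" "S' = (if b' then insert 0 B else B)"
    using assms(2) unfolding supports_def by blast
  have fin: "finite A" "finite B" using A B finite_subset by blast+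
  have "card (S \<union> S') \<le> card (insert 0 (A \<union> B))"
    by (rule card_mono) (use A B fin in auto)
  also have "\<dots> \<le> Suc (card A + card B)"
    using card_Un_le[of A B] card_insert_le_m1[of "Suc (card A + card B)" "A \<union> B" 0] by simp
  finally show ?thesis using A B assms by simp
qed

text \<open>The first coordinate, if present, splits off as the factor \<open>balance\<close>; the
  kernels of the sets of tail coordinates sum to a Krawtchouk value by
  \<open>sum_support_kernel_eq_krawtchouk\<close>.\<close>

lemma idem_kernel:
  assumes "p \<in> X" "p' \<in> X"
  shows "idem b j p p' = (\<Sum>S\<in>supports b j. support_kernel q S (word p) (word p')) / real (card C)"
proof -
  have k: "(\<Sum>S | S \<subseteq> {1..<n} \<and> card S = j. support_kernel q S (word p) (word p')) = kr j p p'"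
    unfolding kr_def dist_alt[OF assms] by (subst sum_support_kernel_eq_krawtchouk) auto
  have "(\<Sum>S\<in>insert 0 ` {S. S \<subseteq> {1..<n} \<and> card S = j}. support_kernel q S (word p) (word p'))
      = (\<Sum>S | S \<subseteq> {1..<n} \<and> card S = j. support_kernel q (insert 0 S) (word p) (word p'))"
  proof (rule sum.reindex_cong[OF _ refl refl])
    show "inj_on (insert 0) {S. S \<subseteq> {1..<n} \<and> card S = j}"
    proof (rule inj_onI)
      fix A B assume AB: "A \<in> {S. S \<subseteq> {1..<n} \<and> card S = j}" "B \<in> {S. S \<subseteq> {1..<n} \<and> card S = j}"
        "insert 0 A = insert 0 B"
      then have "0 \<notin> A" "0 \<notin> B" by auto
      with AB(3) show "A = B" by (metis insert_ident)
    qed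
  qed
  also have "\<dots> = (\<Sum>S | S \<subseteq> {1..<n} \<and> card S = j. balance p p' * support_kernel q S (word p) (word p'))"
  proof (rule sum.cong[OF refl])
    fix S assume "S \<in> {S. S \<subseteq> {1..<n} \<and> card S = j}"
    then have "finite S" "0 \<notin> S" using finite_subset by auto
    then show "support_kernel q (insert 0 S) (word p) (word p') = balance p p' * support_kernel q S (word p) (word p')"
      by (simp add: support_kernel_def balance_def word_def)
  qed
  finally show ?thesis using k by (simp add: idem_def supports_def sum_distrib_left[symmetric])
qed

text \<open>After expansion into kernels only the pairs with \<open>S = S'\<close> survive, and by
  \<open>supports_disjoint\<close> such pairs exist only if the indices agree.\<close>

lemma idem_orthogonal:
  assumes p: "p \<in> X" "p' \<in> X" and ij: "i < s" "j < s"
  shows "(\<Sum>z\<in>X. idem b i p z * idem b' j z p') = (if b = b' \<and> i = j then idem b i p p' else 0)"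
proof -
  let ?c = "real (card C)"
  have "(\<Sum>z\<in>X. idem b i p z * idem b' j z p') =
      (\<Sum>z\<in>X. \<Sum>S\<in>supports b i. \<Sum>S'\<in>supports b' j. support_kernel q S (word p) (word z) * support_kernel q S' (word z) (word p')) / (?c * ?c)"
    using p by (simp add: idem_kernel sum_product sum_divide_distrib)
  also have "(\<Sum>z\<in>X. \<Sum>S\<in>supports b i. \<Sum>S'\<in>supports b' j. support_kernel q S (word p) (word z) * support_kernel q S' (word z) (word p'))
      = (\<Sum>S\<in>supports b i. \<Sum>S'\<in>supports b' j. \<Sum>z\<in>X. support_kernel q S (word p) (word z) * support_kernel q S' (word z) (word p'))"
    by (subst sum.swap) (intro sum.cong refl sum.swap)
  also have "\<dots> = (\<Sum>S\<in>supports b i. \<Sum>S'\<in>supports b' j. if S' = S then ?c * support_kernel q S (word p) (word p') else 0)"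
  proof (intro sum.cong refl)
    fix S S' assume SS: "S \<in> supports b i" "S' \<in> supports b' j"
    have "(\<Sum>z\<in>X. support_kernel q S (word p) (word z) * support_kernel q S' (word z) (word p')) =
        (\<Sum>y\<in>C. support_kernel q S (word p) y * support_kernel q S' y (word p'))"
      by (rule sum_X)
    also have "\<dots> = (if S = S' then ?c * support_kernel q S (word p) (word p') else 0)"
      using support_kernel_orthogonal[OF design _ _ _ supports_card[OF SS ij]] q SS supports_sub word_words p by simp
    finally show "(\<Sum>z\<in>X. support_kernel q S (word p) (word z) * support_kernel q S' (word z) (word p')) =
       (if S' = S then ?c * support_kernel q S (word p) (word p') else 0)" by auto
  qed
  also have "\<dots> = (\<Sum>S\<in>supports b i. if b = b' \<and> i = j then ?c * support_kernel q S (word p) (word p') else 0)"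
  proof (rule sum.cong[OF refl])
    fix S assume "S \<in> supports b i"
    then have "S \<in> supports b' j \<longleftrightarrow> b = b' \<and> i = j" using supports_disjoint by blast
    then show "(\<Sum>S'\<in>supports b' j. if S' = S then ?c * support_kernel q S (word p) (word p') else 0) =
        (if b = b' \<and> i = j then ?c * support_kernel q S (word p) (word p') else 0)"
      by (simp add: finite_supports)
  qed
  finally show ?thesis
    using card_C p by (simp add: idem_kernel sum_distrib_left[symmetric])
qed

lemma idem_sum_orthogonal:
  assumes p: "p \<in> X" "p' \<in> X" and i: "i < s"
  shows "(\<Sum>z\<in>X. idem b i p z * (\<Sum>j<s. idem False j z p' + idem True j z p')) = idem b i p p'"
    and "(\<Sum>z\<in>X. (\<Sum>j<s. idem False j p z + idem True j p z) * idem b i z p') = idem b i p p'"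
proof -
  have "(\<Sum>z\<in>X. idem b i p z * (\<Sum>j<s. idem False j z p' + idem True j z p')) =
     (\<Sum>j<s. (\<Sum>z\<in>X. idem b i p z * idem False j z p') + (\<Sum>z\<in>X. idem b i p z * idem True j z p'))"
    unfolding sum_distrib_left by (subst sum.swap) (simp add: distrib_left sum.distrib)
  also have "\<dots> = (\<Sum>j<s. if j = i then idem b i p p' else 0)"
    using p i by (intro sum.cong) (auto simp: idem_orthogonal)
  finally show "(\<Sum>z\<in>X. idem b i p z * (\<Sum>j<s. idem False j z p' + idem True j z p')) = idem b i p p'"
    using i by simp
  have "(\<Sum>z\<in>X. (\<Sum>j<s. idem False j p z + idem True j p z) * idem b i z p') =
     (\<Sum>j<s. (\<Sum>z\<in>X. idem False j p z * idem b i z p') + (\<Sum>z\<in>X. idem True j p z * idem b i z p'))"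
    unfolding sum_distrib_right by (subst sum.swap) (simp add: distrib_right sum.distrib)
  also have "\<dots> = (\<Sum>j<s. if j = i then idem b i p p' else 0)"
    using p i by (intro sum.cong) (auto simp: idem_orthogonal)
  finally show "(\<Sum>z\<in>X. (\<Sum>j<s. idem False j p z + idem True j p z) * idem b i z p') = idem b i p p'"
    using i by simp
qed

lemma idem_rest:
  assumes p: "p \<in> X" "p' \<in> X" and i: "i < s"
  shows "(\<Sum>z\<in>X. idem b i p z * rest z p') = 0" "(\<Sum>z\<in>X. rest p z * idem b i z p') = 0"
  unfolding rest_def right_diff_distrib left_diff_distrib sum_subtractf
    idem_sum_orthogonal[OF assms] sum_of_bool_mult[OF finite_X p(2)] sum_of_bool_mult[OF finite_X p(1)]
  by simp_all

text \<open>The sum subtracted in the second factor is annihilated by the first, so only the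
  identity is left of it.\<close>

lemma rest_rest:
  assumes p: "p \<in> X" "p' \<in> X"
  shows "(\<Sum>z\<in>X. rest p z * rest z p') = rest p p'"
proof -
  have "(\<Sum>z\<in>X. rest p z * (\<Sum>j<s. idem False j z p' + idem True j z p')) =
     (\<Sum>j<s. (\<Sum>z\<in>X. rest p z * idem False j z p') + (\<Sum>z\<in>X. rest p z * idem True j z p'))"
    unfolding sum_distrib_left by (subst sum.swap) (simp add: distrib_left sum.distrib)
  also have "\<dots> = 0" using idem_rest[OF p] by simp
  finally have "(\<Sum>z\<in>X. rest p z * rest z p') = (\<Sum>z\<in>X. rest p z * of_bool (z = p'))"
    unfolding rest_def[of _ p'] right_diff_distrib sum_subtractf by simp
  then show ?thesis using sum_of_bool_mult[OF finite_X] p by simp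
qed

text \<open>The two idempotents with the same \<open>j\<close> add up with the factor
  \<open>1 + balance\<close>, which is q inside a block and 0 between blocks. This accounts for the
  zeros in the extra column of the eigenmatrix.\<close>

lemma rest_value:
  "rest p p' = of_bool (p = p') - (if fst p = fst p' then real q * (\<Sum>l<s. kr l p p') / real (card C) else 0)"
proof -
  have "(\<Sum>j<s. idem False j p p' + idem True j p p') =
      (\<Sum>j<s. (if fst p = fst p' then real q else 0) / real (card C) * kr j p p')"
    by (intro sum.cong) (auto simp: idem_def balance_def left_diff_distrib add_divide_distrib[symmetric])
  then show ?thesis by (simp only: rest_def sum_distrib_left[symmetric]) simp
qed

lemma rest_sym: "p \<in> X \<Longrightarrow> p' \<in> X \<Longrightarrow> rest p p' = rest p' p"
  unfolding rest_value kr_def by (auto simp: dist_sym)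

section \<open>Tightness and the vanishing of \<open>rest\<close>\<close>

definition tight where "tight \<longleftrightarrow> real (card C) = real q * (\<Sum>l<s. krawtchouk (n - 1) q l 0)"

lemma tight_iff: "tight_odd_design n q s C \<longleftrightarrow> tight"
proof -
  have "real ((\<Sum>k = 0..s - 1. (n choose k) * (q - 1) ^ k) + ((n - 1) choose (s - 1)) * (q - 1) ^ s)
      = real q * (\<Sum>l<s. krawtchouk (n - 1) q l 0)"
    by (rule tight_bound_eq) (use n q s in auto)
  then show ?thesis
    unfolding tight_odd_design_def tight_def using design of_nat_eq_iff by metis
qed

lemma kr_refl: "kr l p p = krawtchouk (n - 1) q l 0"
  by (simp add: kr_def dist_def hamming_dist_def)

lemma krawtchouk_0_pos: "l < s \<Longrightarrow> krawtchouk (n - 1) q l 0 > 0"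
  using q strength by (simp add: krawtchouk_0)

lemma rest_refl: "rest p p = 0 \<longleftrightarrow> tight"
  unfolding rest_value tight_def kr_refl using card_C by (auto simp: field_simps)

text \<open>As \<open>rest\<close> is symmetric and idempotent, each diagonal entry is the sum of
  the squares of its row; a zero diagonal makes every entry zero.\<close>

lemma rest_tight:
  assumes "tight" "p \<in> X" "p' \<in> X" shows "rest p p' = 0"
proof -
  have "(\<Sum>z\<in>X. (rest p z)\<^sup>2) = (\<Sum>z\<in>X. rest p z * rest z p)"
    using assms(2) rest_sym by (intro sum.cong) (auto simp: power2_eq_square)
  also have "\<dots> = 0" using rest_rest[OF assms(2,2)] assms(1) rest_refl by simp
  finally have "(rest p p')\<^sup>2 = 0" using assms finite_X by (simp add: sum_nonneg_eq_0_iff)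
  then show ?thesis by simp
qed

section \<open>Quadrature and the distances inside blocks\<close>

text \<open>For \<open>r = 0\<close> this is a design sum over \<open>insert 0 K\<close>, where the
  mean of \<open>balance\<close> over the first coordinate is zero. Higher powers reduce to it: one
  factor \<open>dist p z\<close> is written as the sum of the indicators of differing coordinates,
  each of which enlarges \<open>K\<close> by at most one element. The first coordinate uses one unit
  of the strength 2s - 1, hence the bound 2s - 2.\<close>

lemma quadrature_power:
  assumes "p \<in> X" "K \<subseteq> {1..<n}" "card K + r \<le> 2 * s - 2"
  shows "(\<Sum>z\<in>X. balance p z * (\<Prod>k\<in>K. of_bool (word p ! k \<noteq> word z ! k)) * real (dist p z) ^ r) = 0"
  using assms(2,3)
proof (induction r arbitrary: K)
  case 0
  define g :: "nat \<Rightarrow> nat \<Rightarrow> real" where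
    "g = (\<lambda>k a. if k = 0 then real q * of_bool (fst p = a) - 1 else of_bool (word p ! k \<noteq> a))"
  have K: "finite K" "0 \<notin> K" using 0 finite_subset by auto
  have "balance p z * (\<Prod>k\<in>K. of_bool (word p ! k \<noteq> word z ! k)) = (\<Prod>k\<in>insert 0 K. g k (word z ! k))" for z
  proof -
    have "(\<Prod>k\<in>K. g k (word z ! k)) = (\<Prod>k\<in>K. of_bool (word p ! k \<noteq> word z ! k))"
      by (rule prod.cong[OF refl]) (use K in \<open>metis g_def\<close>)
    moreover have "g 0 (word z ! 0) = balance p z" by (simp add: g_def balance_def word_def)
    ultimately show ?thesis using K by simp
  qed
  then have "(\<Sum>z\<in>X. balance p z * (\<Prod>k\<in>K. of_bool (word p ! k \<noteq> word z ! k)) * real (dist p z) ^ 0) =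
      (\<Sum>z\<in>X. \<Prod>k\<in>insert 0 K. g k (word z ! k))" by simp
  also have "\<dots> = (\<Sum>y\<in>C. \<Prod>k\<in>insert 0 K. g k (y ! k))" by (rule sum_X)
  also have "\<dots> = real (card C) * (\<Prod>k\<in>insert 0 K. (\<Sum>a\<in>{1..q}. g k a) / real q)"
    by (rule design_sum_prod[OF design]) (use q n 0 K s in auto)
  also have "(\<Sum>a\<in>{1..q}. g 0 a) = 0"
    using assms(1) by (simp add: g_def sum_subtractf sum_distrib_left[symmetric] block_union_def mem_Times_iff Sigma_def) auto
  then have "(\<Prod>k\<in>insert 0 K. (\<Sum>a\<in>{1..q}. g k a) / real q) = 0" using K by simp
  finally show ?case by simp
next
  case (Suc r)
  have fin: "finite K" using Suc.prems finite_subset by auto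
  have step: "(\<Prod>k\<in>K. of_bool (word p ! k \<noteq> word z ! k)) * real (dist p z) =
     (\<Sum>k'\<in>{1..<n}. \<Prod>k\<in>insert k' K. of_bool (word p ! k \<noteq> word z ! k))" if "z \<in> X" for z
  proof -
    \<comment> \<open>If \<open>k'\<close> lies in \<open>K\<close> already, its indicator is
      repeated, and an indicator equals its square.\<close>
    have "(\<Prod>k\<in>insert k' K. of_bool (word p ! k \<noteq> word z ! k)) =
        (\<Prod>k\<in>K. of_bool (word p ! k \<noteq> word z ! k)) * (of_bool (word p ! k' \<noteq> word z ! k') :: real)" for k'
      using fin by (cases "k' \<in> K") (auto simp: insert_absorb prod.insert of_bool_def prod_zero)
    moreover have "real (dist p z) = (\<Sum>k'\<in>{1..<n}. of_bool (word p ! k' \<noteq> word z ! k'))"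
      unfolding dist_alt[OF assms(1) that] by (simp add: of_bool_def sum.If_cases Int_def)
    ultimately show ?thesis by (simp add: sum_distrib_left)
  qed
  have "(\<Sum>z\<in>X. balance p z * (\<Prod>k\<in>K. of_bool (word p ! k \<noteq> word z ! k)) * real (dist p z) ^ Suc r) =
     (\<Sum>z\<in>X. balance p z * ((\<Prod>k\<in>K. of_bool (word p ! k \<noteq> word z ! k)) * real (dist p z)) * real (dist p z) ^ r)"
    by (simp add: algebra_simps)
  also have "\<dots> = (\<Sum>z\<in>X. \<Sum>k'\<in>{1..<n}. balance p z * (\<Prod>k\<in>insert k' K. of_bool (word p ! k \<noteq> word z ! k)) * real (dist p z) ^ r)"
    by (intro sum.cong refl) (simp only: step sum_distrib_left sum_distrib_right)
  also have "\<dots> = (\<Sum>k'\<in>{1..<n}. \<Sum>z\<in>X. balance p z * (\<Prod>k\<in>insert k' K. of_bool (word p ! k \<noteq> word z ! k)) * real (dist p z) ^ r)"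
    by (rule sum.swap)
  also have "\<dots> = 0"
  proof (rule sum.neutral, rule ballI)
    fix k' assume "k' \<in> {1..<n}"
    moreover have "card (insert k' K) \<le> Suc (card K)" using fin by (simp add: card_insert_if)
    ultimately show "(\<Sum>z\<in>X. balance p z * (\<Prod>k\<in>insert k' K. of_bool (word p ! k \<noteq> word z ! k)) * real (dist p z) ^ r) = 0"
      using Suc.prems by (intro Suc.IH) auto
  qed
  finally show ?case .
qed

lemma quadrature:
  assumes "p \<in> X" "degree f \<le> 2 * s - 2"
  shows "(\<Sum>z\<in>X. balance p z * poly f (real (dist p z))) = 0"
proof -
  have "(\<Sum>z\<in>X. balance p z * poly f (real (dist p z))) =
      (\<Sum>r\<le>degree f. coeff f r * (\<Sum>z\<in>X. balance p z * real (dist p z) ^ r))"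
    unfolding poly_altdef sum_distrib_left by (subst sum.swap) (simp add: algebra_simps)
  also have "\<dots> = 0"
    using quadrature_power[OF assms(1), of "{}"] assms(2) by (intro sum.neutral) auto
  finally show ?thesis .
qed

text \<open>Since \<open>rest\<close> vanishes, every nonzero distance inside a block is a root of
  the sum of the first \<open>s\<close> Krawtchouk polynomials. That sum is positive at 0 and has
  degree at most s - 1, so it cannot have all \<open>s\<close> degrees as roots.\<close>

lemma tight_degree_missing:
  assumes tight
  shows "\<exists>j\<in>{1..s}. \<forall>p\<in>X. \<forall>p'\<in>X. fst p = fst p' \<longrightarrow> dist p p' \<noteq> \<alpha> j"
proof (rule ccontr)
  assume contr: "\<not> ?thesis"
  obtain k where k: "\<And>l. degree (k l) \<le> l" "\<And>l x. poly (k l) x = krawtchouk (n - 1) q l x"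
    using krawtchouk_polynomial[of _ "n - 1" q] by metis
  define f where "f = (\<Sum>l<s. k l)"
  have "poly f 0 > 0"
    unfolding f_def poly_sum k(2) using krawtchouk_0_pos s by (intro sum_pos) (auto simp: lessThan_empty_iff)
  then have f0: "f \<noteq> 0" by auto
  have "degree f \<le> s - 1" unfolding f_def
  proof (rule degree_sum_le)
    show "degree (k l) \<le> s - 1" if "l \<in> {..<s}" for l using k(1)[of l] that by simp
  qed simp
  have "(\<lambda>j. real (\<alpha> j)) ` {1..s} \<subseteq> {x. poly f x = 0}"
  proof safe
    fix j assume j: "j \<in> {1..s}"
    then obtain p p' where p: "p \<in> X" "p' \<in> X" "fst p = fst p'" "dist p p' = \<alpha> j"
      using contr by blast
    then have "p \<noteq> p'" using \<alpha>_pos[OF j] dist_0[OF p(1,2,3)] by auto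
    then have "(\<Sum>l<s. kr l p p') = 0"
      using rest_tight[OF assms p(1,2)] p(3) q card_C by (auto simp: rest_value)
    then show "poly f (real (\<alpha> j)) = 0" by (simp add: f_def poly_sum k kr_def p)
  qed
  then have "card ((\<lambda>j. real (\<alpha> j)) ` {1..s}) \<le> card {x. poly f x = 0}"
    using poly_roots_finite[OF f0] card_mono by blast
  also have "\<dots> \<le> degree f" by (rule card_poly_roots_bound[OF f0])
  finally have "card ((\<lambda>j. real (\<alpha> j)) ` {1..s}) \<le> degree f" .
  moreover have "card ((\<lambda>j. real (\<alpha> j)) ` {1..s}) = s"
  proof -
    have "inj_on (\<lambda>j. real (\<alpha> j)) {1..s}"
    proof (rule inj_onI)
      fix i j assume "i \<in> {1..s}" "j \<in> {1..s}" "real (\<alpha> i) = real (\<alpha> j)"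
      then show "i = j" using \<alpha>_inj[of i j] by simp
    qed
    from card_image[OF this] show ?thesis by simp
  qed
  ultimately show False using \<open>degree f \<le> s - 1\<close> s by simp
qed

text \<open>The quadrature rule compares distances inside the block of a point with distances to the
  other blocks. If the largest degree occurred inside a block, a polynomial vanishing on all
  distances inside blocks would leave at most \<open>s - 1\<close> distances between blocks, and the square of
  the polynomial having these as roots would force \<open>\<alpha> s\<close> to be one of them; but they are less
  than \<open>\<alpha> s\<close>.\<close>

lemma tight_no_largest_degree:
  assumes tight and p: "p \<in> X" "p' \<in> X" "fst p = fst p'"
  shows "dist p p' \<noteq> \<alpha> s"
proof
  assume ps: "dist p p' = \<alpha> s"
  obtain j where j: "j \<in> {1..s}" "\<And>a b. a \<in> X \<Longrightarrow> b \<in> X \<Longrightarrow> fst a = fst b \<Longrightarrow> dist a b \<noteq> \<alpha> j"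
    using tight_degree_missing[OF assms(1)] by blast
  with p ps have js: "j \<noteq> s" by blast
  \<comment> \<open>The indices left after removing the missing degree and the largest one: a
    distance inside a block is 0, \<alpha> s or \<alpha> i with \<open>i\<close> in
    \<open>J\<close>.\<close>
  define J where "J = {1..<s} - {j}"
  have cJ: "card J = s - 2" "finite J" using j(1) js by (auto simp: J_def)
  have s2: "s \<ge> 2" using j(1) js by auto
  define V where "V = {dist a b | a b. a \<in> X \<and> b \<in> X \<and> fst a \<noteq> fst b}"
  have V_less: "v < \<alpha> s" if "v \<in> V" for v
  proof -
    from that obtain a b where "a \<in> X" "b \<in> X" "fst a \<noteq> fst b" "v = dist a b"
      unfolding V_def by blast
    then have "Suc v \<in> \<alpha> ` {1..s}" using dist_degree[of a b] by auto
    then show ?thesis using \<alpha>_le by fastforce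
  qed
  have same: "dist a b = 0 \<or> dist a b = \<alpha> s \<or> dist a b \<in> \<alpha> ` J" if ab: "a \<in> X" "b \<in> X" "fst a = fst b" for a b
  proof (cases "a = b")
    case False
    then obtain i where i: "i \<in> {1..s}" "dist a b = \<alpha> i" using dist_degree[OF ab(1,2)] ab(3) by auto
    then have "i \<noteq> j" using j(2)[OF ab] by auto
    then show ?thesis using i by (cases "i = s") (auto simp: J_def)
  qed (use ab dist_0 in auto)
  define h :: "real poly" where "h = (\<Prod>i\<in>J. [:- real (\<alpha> i), 1:])"
  \<comment> \<open>Chosen to vanish at all distances inside blocks. Distances between blocks are
    below \<alpha> s, so \<open>f\<close> is nonnegative there; its degree is at most 2 + 2 (s - 2)
    = 2s - 2, as \<open>quadrature\<close> demands.\<close>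
  define f where "f = [:0, 1:] * ([:real (\<alpha> s), -1:] * (h * h))"
  have dh: "degree h \<le> s - 2"
    using degree_prod_sum_le[OF cJ(2), of "\<lambda>i. [:- real (\<alpha> i), 1:]"] cJ(1) by (simp add: h_def o_def)
  have "degree f \<le> 1 + (1 + (degree h + degree h))"
    unfolding f_def by (intro order.trans[OF degree_mult_le] add_mono) auto
  then have df: "degree f \<le> 2 * s - 2" using dh s2 by linarith
  have ph: "poly h x = (\<Prod>i\<in>J. x - real (\<alpha> i))" for x by (simp add: h_def poly_prod)
  have pf: "poly f x = x * ((real (\<alpha> s) - x) * (poly h x)\<^sup>2)" for x
    by (simp add: f_def power2_eq_square algebra_simps)
  have "V \<subseteq> insert 0 (\<alpha> ` J)"
  proof
    fix v assume v: "v \<in> V"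
    then obtain a b where ab: "a \<in> X" "b \<in> X" "fst a \<noteq> fst b" "v = dist a b" unfolding V_def by blast
    have "balance a z * poly f (real (dist a z)) \<le> 0" if z: "z \<in> X" for z
    proof (cases "fst a = fst z")
      case True
      then have "poly f (real (dist a z)) = 0"
        using same[OF ab(1) z] cJ(2) by (auto simp: pf ph)
      then show ?thesis by simp
    next
      case False
      then have "dist a z < \<alpha> s" using V_less ab(1) z V_def by blast
      then have "poly f (real (dist a z)) \<ge> 0" by (simp add: pf)
      then show ?thesis using False by (simp add: balance_def)
    qed
    \<comment> \<open>The terms have one sign and sum to zero, so each vanishes; hence every
      distance between blocks is a root of \<open>f\<close>.\<close>
    then have "balance a b * poly f (real (dist a b)) = 0"
      using quadrature[OF ab(1) df] ab(2) finite_X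
        sum_nonneg_eq_0_iff[of X "\<lambda>z. - (balance a z * poly f (real (dist a z)))"]
      by (auto simp: sum_negf)
    then have "poly f (real v) = 0" using ab by (simp add: balance_def)
    then show "v \<in> insert 0 (\<alpha> ` J)"
      using V_less[OF v] cJ(2) by (auto simp: pf ph)
  qed
  then have "finite V" "card V \<le> card (insert 0 (\<alpha> ` J))"
    using cJ(2) by (auto intro: finite_subset card_mono)
  moreover have "card (insert 0 (\<alpha> ` J)) \<le> Suc (card J)"
    using cJ(2) card_image_le[OF cJ(2), of \<alpha>] by (simp add: card_insert_if)
  ultimately have V: "finite V" "card V \<le> s - 1" using cJ(1) s2 by auto
  \<comment> \<open>The square of \<open>k\<close> has degree at most 2s - 2 and vanishes at all
    distances between blocks. Only the block of \<open>p\<close> contributes, with weight q - 1 > 0,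
    so the term at \<open>p'\<close> is zero and \<alpha> s is a root of \<open>k\<close>.\<close>
  define k :: "real poly" where "k = (\<Prod>v\<in>V. [:- real v, 1:])"
  have "degree k \<le> card V"
    using degree_prod_sum_le[OF V(1), of "\<lambda>v. [:- real v, 1:]"] by (simp add: k_def o_def)
  then have dg: "degree (k * k) \<le> 2 * s - 2" using V(2) degree_mult_le[of k k] by linarith
  have pk: "poly k x = (\<Prod>v\<in>V. x - real v)" for x by (simp add: k_def poly_prod)
  have "balance p z * poly (k * k) (real (dist p z)) \<ge> 0" if z: "z \<in> X" for z
  proof (cases "fst p = fst z")
    case True
    then show ?thesis using q by (simp add: balance_def)
  next
    case False
    then have "dist p z \<in> V" using p(1) z V_def by blast
    then have "poly k (real (dist p z)) = 0" using V(1) by (auto simp: pk)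
    then show ?thesis by simp
  qed
  then have "balance p p' * poly (k * k) (real (dist p p')) = 0"
    using quadrature[OF p(1) dg] p(2) finite_X by (simp only: sum_nonneg_eq_0_iff)
  then have "poly k (real (\<alpha> s)) = 0" using p(3) q ps by (simp add: balance_def)
  then have "\<alpha> s \<in> V" using V(1) by (auto simp: pk)
  then show False using V_less by blast
qed

section \<open>The scheme and its second eigenmatrix\<close>

lemma same_block_rel_iff:
  "(p, p') \<in> same_block_rel q C d \<longleftrightarrow> p \<in> X \<and> p' \<in> X \<and> fst p = fst p' \<and> p \<noteq> p' \<and> dist p p' = d"
  by (cases p; cases p') (auto simp: same_block_rel_def block_union_def dist_def)

lemma diff_block_rel_iff:
  "(p, p') \<in> diff_block_rel q C d \<longleftrightarrow> p \<in> X \<and> p' \<in> X \<and> fst p \<noteq> fst p' \<and> dist p p' = d"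
  by (cases p; cases p') (auto simp: diff_block_rel_def block_union_def dist_def)

text \<open>The value of |C| times \<open>rest\<close> at two points of one block with tail distance
  \<alpha> i, that is, the extra column of the case that is not tight.\<close>

definition rest_entry :: "nat \<Rightarrow> real" where
  "rest_entry i = (if i = 0 then real (card C) else 0) - real q * (\<Sum>l<s. krawtchouk (n - 1) q l (real (\<alpha> i)))"

text \<open>One formula for both eigenmatrices. Columns below \<open>s\<close> belong to
  \<open>idem False\<close>, columns from \<open>m\<close> on to \<open>idem True\<close>; column
  \<open>s\<close> belongs to \<open>rest\<close> exactly if \<open>m = s + 1\<close>. Row
  \<open>i\<close> with \<open>i \<ge> m\<close> belongs to the relation between blocks with index
  \<open>i - m + 1\<close>.\<close>

definition entry :: "nat \<Rightarrow> nat \<Rightarrow> nat \<Rightarrow> real" where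
  "entry m i j = (if i < m
     then (if j < s then krawtchouk (n - 1) q j (real (\<alpha> i)) else if j < m then rest_entry i
           else (real q - 1) * krawtchouk (n - 1) q (j - m) (real (\<alpha> i)))
     else (if j < s then krawtchouk (n - 1) q j (real (\<alpha> (i - m + 1)) - 1) else if j < m then 0
           else - krawtchouk (n - 1) q (j - m) (real (\<alpha> (i - m + 1)) - 1)))"

text \<open>Here \<open>m\<close> is the number of relations inside blocks, \<open>R 0\<close> included.\<close>

lemma scheme:
  assumes m: "m = (if tight then s else s + 1)"
    and R0: "R 0 = Id_on X"
    and RT: "\<And>i. 1 \<le> i \<Longrightarrow> i < m \<Longrightarrow> R i = same_block_rel q C (\<alpha> i)"
    and RU: "\<And>i. i < s \<Longrightarrow> R (m + i) = diff_block_rel q C (\<alpha> (i + 1) - 1)"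
    and D: "D + 1 = m + s"
  shows "association_scheme X D R \<and> second_eigenmatrix X D R (mat (m + s) (m + s) (\<lambda>(i, j). entry m i j))"
proof -
  have ms: "s \<le> m" "m \<le> s + 1" using m by auto
  define e where "e = (\<lambda>j. if j < s then idem False j else if j < m then rest else idem True (j - m))"
  have inside: "p \<in> X \<and> p' \<in> X \<and> fst p = fst p' \<and> dist p p' = \<alpha> i \<and> (p = p' \<longleftrightarrow> i = 0)"
    if "i < m" "(p, p') \<in> R i" for i p p'
  proof (cases "i = 0")
    case True
    then show ?thesis using that R0 \<alpha>0 dist_0[of p p'] by auto
  next
    case False
    then show ?thesis using that RT[of i] by (simp add: same_block_rel_iff)
  qed
  have outside: "p \<in> X \<and> p' \<in> X \<and> fst p \<noteq> fst p' \<and> dist p p' = \<alpha> (i - m + 1) - 1"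
    if "m \<le> i" "i \<le> D" "(p, p') \<in> R i" for i p p'
    using RU[of "i - m"] that D by (simp add: diff_block_rel_iff)
  have outside_real: "real (dist p p') = real (\<alpha> (i - m + 1)) - 1"
    if "m \<le> i" "i \<le> D" "(p, p') \<in> R i" for i p p'
    using outside[OF that] \<alpha>_pos[of "i - m + 1"] that D by (simp add: of_nat_diff)
  have cover: "\<exists>i\<le>D. (p, p') \<in> R i" if p: "p \<in> X" "p' \<in> X" for p p'
  proof (cases "p = p'")
    case True
    then show ?thesis using R0 p by auto
  next
    case False
    then obtain i where i: "i \<in> {1..s}" "of_bool (fst p \<noteq> fst p') + dist p p' = \<alpha> i"
      using dist_degree[OF p] by (metis imageE)
    show ?thesis
    proof (cases "fst p = fst p'")
      case True
      \<comment> \<open>In the tight case \<open>m = s\<close>, and the index \<open>s\<close> is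
        ruled out by \<open>tight_no_largest_degree\<close>.\<close>
      then have "i < m"
        using tight_no_largest_degree[OF _ p] i m by (cases "i = s") (auto split: if_splits)
      moreover have "(p, p') \<in> R i"
        using RT[OF _ \<open>i < m\<close>] i p True False by (simp add: same_block_rel_iff)
      ultimately show ?thesis using D s by (intro exI[of _ i]) simp
    next
      case False
      then have "(p, p') \<in> R (m + (i - 1))"
        using RU[of "i - 1"] i p by (auto simp: diff_block_rel_iff)
      moreover have "m + (i - 1) \<le> D" using i D by auto
      ultimately show ?thesis by blast
    qed
  qed
  show ?thesis
  proof (rule association_scheme_of_idempotents[where e = e])
    show "finite X" "X \<noteq> {}" "R 0 = Id_on X" by (fact finite_X X_nonempty R0)+
    show "sym (R i)" if "i \<le> D" for i
    proof (rule symI)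
      fix p p' assume pp: "(p, p') \<in> R i"
      show "(p', p) \<in> R i"
      proof (cases "i < m")
        case True
        then show ?thesis
          using inside[OF True pp] R0 RT[of i] dist_sym[of p p'] by (cases "i = 0") (auto simp: same_block_rel_iff)
      next
        case False
        then show ?thesis
          using outside[OF _ that pp] RU[of "i - m"] dist_sym[of p p'] that D by (auto simp: diff_block_rel_iff)
      qed
    qed
    show "R i \<inter> R j = {}" if "i \<le> D" "j \<le> D" "i \<noteq> j" for i j
    proof (rule ccontr)
      assume "R i \<inter> R j \<noteq> {}"
      then obtain p p' where pi: "(p, p') \<in> R i" and pj: "(p, p') \<in> R j" by auto
      show False
      proof (cases "i < m")
        case True
        then have "j < m" using inside[OF True pi] outside[OF _ that(2) pj] by fastforce
        then show False
          using inside[OF True pi] inside[OF _ pj] \<alpha>_inj[of i j] that ms True by auto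
      next
        case False
        then have "m \<le> j" using outside[OF _ that(1) pi] inside[OF _ pj] by fastforce
        then have "real (\<alpha> (i - m + 1)) = real (\<alpha> (j - m + 1))"
          using outside_real[OF _ that(1) pi] outside_real[OF _ that(2) pj] False by simp
        moreover have "i - m + 1 \<le> s" "j - m + 1 \<le> s" using that D False \<open>m \<le> j\<close> by linarith+
        ultimately have "i - m + 1 = j - m + 1" by (intro \<alpha>_inj[of "i - m + 1" "j - m + 1"]) simp_all
        then show False using that \<open>m \<le> j\<close> False by simp
      qed
    qed
    show "(\<Union>i\<le>D. R i) = X \<times> X"
    proof (intro equalityI subsetI)
      fix x assume "x \<in> (\<Union>i\<le>D. R i)"
      then obtain i p p' where i: "i \<le> D" "(p, p') \<in> R i" "x = (p, p')" by (cases x) auto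
      then show "x \<in> X \<times> X"
        using inside[of i p p'] outside[of i p p'] by (cases "i < m") auto
    next
      fix x assume "x \<in> X \<times> X"
      then show "x \<in> (\<Union>i\<le>D. R i)" using cover[of "fst x" "snd x"] by (auto simp: mem_Times_iff)
    qed
    show "mat (m + s) (m + s) (\<lambda>(i, j). entry m i j) \<in> carrier_mat (D + 1) (D + 1)" using D by simp
    \<comment> \<open>Column 0 belongs to \<open>idem False 0\<close>, which is J / |X|.\<close>
    have krawtchouk_first: "krawtchouk k q 0 x = 1" for k x by (simp add: krawtchouk_def)
    show "mat (m + s) (m + s) (\<lambda>(i, j). entry m i j) $$ (i, 0) = 1" if "i \<le> D" for i
      using that D s by (simp add: entry_def krawtchouk_first)
    show "real (card X) * e j p p' = mat (m + s) (m + s) (\<lambda>(i, j). entry m i j) $$ (i, j)"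
      if i: "i \<le> D" and j: "j \<le> D" and pp: "(p, p') \<in> R i" for i j p p'
    proof -
      have "real (card C) * e j p p' = entry m i j"
      proof (cases "i < m")
        case True
        note in_i = inside[OF True pp]
        have "kr l p p' = krawtchouk (n - 1) q l (real (\<alpha> i))" for l using in_i by (simp add: kr_def)
        moreover have "balance p p' = real q - 1" using in_i by (simp add: balance_def)
        moreover have "real (card C) * rest p p' = rest_entry i"
          using in_i card_C calculation(1) by (simp add: rest_value rest_entry_def right_diff_distrib)
        ultimately show ?thesis using True card_C by (simp add: e_def entry_def idem_def)
      next
        case False
        then have mi: "m \<le> i" by simp
        have "kr l p p' = krawtchouk (n - 1) q l (real (\<alpha> (i - m + 1)) - 1)" for l
          using outside_real[OF mi i pp] by (simp add: kr_def)
        moreover have "balance p p' = - 1" using outside[OF mi i pp] by (simp add: balance_def)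
        moreover have "rest p p' = 0" using outside[OF mi i pp] by (auto simp: rest_value)
        ultimately show ?thesis using False card_C by (simp add: e_def entry_def idem_def)
      qed
      then show ?thesis using i j D by (simp add: card_X)
    qed
    show "(\<Sum>z\<in>X. e i p z * e j z p') = (if i = j then e i p p' else 0)"
      if ij: "i \<le> D" "j \<le> D" and p: "p \<in> X" "p' \<in> X" for i j p p'
    proof -
      \<comment> \<open>Recovers from a column index the idempotent that it denotes, so that
        orthogonality can be settled by cases.\<close>
      have kind: "(\<exists>b l. l < s \<and> e k = idem b l \<and> k = (if b then m + l else l)) \<or> s < m \<and> e k = rest \<and> k = s"
        if k: "k \<le> D" for k
      proof (cases "k < m")
        case True
        then show ?thesis using ms by (cases "k < s") (auto simp: e_def)
      next
        case False
        then have "k - m < s \<and> e k = idem True (k - m) \<and> k = m + (k - m)"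
          using k D ms by (auto simp: e_def)
        then show ?thesis by force
      qed
      from kind[OF ij(1)] show ?thesis
      proof (elim disjE exE conjE)
        fix b l assume l: "l < s" and ei: "e i = idem b l" and il: "i = (if b then m + l else l)"
        from kind[OF ij(2)] show ?thesis
        proof (elim disjE exE conjE)
          fix b' l' assume l': "l' < s" and ej: "e j = idem b' l'" and jl: "j = (if b' then m + l' else l')"
          have "i = j \<longleftrightarrow> b = b' \<and> l = l'" using il jl l l' ms by (auto split: if_splits)
          then show ?thesis unfolding ei ej idem_orthogonal[OF p l l'] by simp
        next
          assume "s < m" and ej: "e j = rest" and "j = s"
          then have "i \<noteq> j" using il l by (auto split: if_splits)
          then show ?thesis unfolding ei ej idem_rest[OF p l] by simp
        qed
      next
        assume "s < m" and ei: "e i = rest" and i_s: "i = s"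
        from kind[OF ij(2)] show ?thesis
        proof (elim disjE exE conjE)
          fix b' l' assume l': "l' < s" and ej: "e j = idem b' l'" and jl: "j = (if b' then m + l' else l')"
          then have "i \<noteq> j" using i_s \<open>s < m\<close> by (auto split: if_splits)
          then show ?thesis unfolding ei ej idem_rest[OF p l'] by simp
        next
          assume "e j = rest" and "j = s"
          then show ?thesis using ei i_s rest_rest[OF p] by simp
        qed
      qed
    qed
    show "\<exists>p\<in>X. \<exists>p'\<in>X. e i p p' \<noteq> 0" if "i \<le> D" for i
    proof -
      \<comment> \<open>A diagonal entry suffices: Krawtchouk values at 0 are positive in the range
        used, and the diagonal of \<open>rest\<close> vanishes only for tight designs.\<close>
      obtain p where p: "p \<in> X" using X_nonempty by blast
      have "idem b l p p \<noteq> 0" if "l < s" for b l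
        using krawtchouk_0_pos[OF that] q card_C by (simp add: idem_def kr_refl balance_def)
      moreover have "rest p p \<noteq> 0" if "s < m" using that m rest_refl by (auto split: if_splits)
      ultimately have "e i p p \<noteq> 0" using that D by (auto simp: e_def)
      then show ?thesis using p by blast
    qed
  qed
qed

end

theorem theorem3p3:
  fixes n q s :: nat and C :: "nat list set" and \<alpha> :: "nat \<Rightarrow> nat"
  assumes "n \<ge> 2" and "q \<ge> 2" and "s \<ge> 1"
    and "hamming_design n q (2 * s - 1) C"
    and "code_degree C = s"
    and "degree_set C = \<alpha> ` {1..s}" and "strict_mono_on {1..s} \<alpha>" and "\<alpha> 0 = 0"
  shows
    "let X = block_union q C;
         T = (\<lambda>j. same_block_rel q C (\<alpha> j));
         U = (\<lambda>j. diff_block_rel q C (\<alpha> j - 1));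
         M = krawtchouk_mat (n - 1) q s;
         M\<^sub>U = M (map (\<lambda>j. real (\<alpha> j) - 1) [1..<s + 1])
     in
       (tight_odd_design n q s C \<longrightarrow>
         (let R = (!) ([Id_on X] @ map T [1..<s] @ map U [1..<s + 1]);
              M\<^sub>T = M (map (\<lambda>j. real (\<alpha> j)) [0..<s])
          in association_scheme X (2 * s - 1) R \<and>
             second_eigenmatrix X (2 * s - 1) R
               (four_block_mat M\<^sub>T ((real q - 1) \<cdot>\<^sub>m M\<^sub>T)
                               M\<^sub>U (- M\<^sub>U)))) \<and>
       (\<not> tight_odd_design n q s C \<longrightarrow>
         (let R = (!) ([Id_on X] @ map T [1..<s + 1] @ map U [1..<s + 1]);
              M\<^sub>T = M (map (\<lambda>j. real (\<alpha> j)) [0..<s + 1]);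
              c = mat (s + 1) 1 (\<lambda>(i, _).
                    if i = 0
                    then real (card C) - real q * (\<Sum>l = 0..s - 1. krawtchouk (n - 1) q l (real (\<alpha> 0)))
                    else - real q * (\<Sum>l = 0..s - 1. krawtchouk (n - 1) q l (real (\<alpha> i))))
          in association_scheme X (2 * s) R \<and>
             second_eigenmatrix X (2 * s) R
               (four_block_mat M\<^sub>T (beside c ((real q - 1) \<cdot>\<^sub>m M\<^sub>T))
                               M\<^sub>U (beside (0\<^sub>m s 1) (- M\<^sub>U)))))"
proof -
  interpret odd_design n q s C \<alpha> by standard (use assms in auto)
  define T where "T = (\<lambda>j. same_block_rel q C (\<alpha> j))"
  define U where "U = (\<lambda>j. diff_block_rel q C (\<alpha> j - 1))"
  define M where "M = krawtchouk_mat (n - 1) q s"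
  define M\<^sub>U where "M\<^sub>U = M (map (\<lambda>j. real (\<alpha> j) - 1) [1..<s + 1])"
  have MU: "M\<^sub>U \<in> carrier_mat s s"
    "\<And>i j. i < s \<Longrightarrow> j < s \<Longrightarrow> M\<^sub>U $$ (i, j) = krawtchouk (n - 1) q j (real (\<alpha> (i + 1)) - 1)"
    by (auto simp: M\<^sub>U_def M_def krawtchouk_mat_def simp del: upt_Suc)
  have MT: "M (map (\<lambda>j. real (\<alpha> j)) [0..<r]) \<in> carrier_mat r s"
    "\<And>i j. i < r \<Longrightarrow> j < s \<Longrightarrow> M (map (\<lambda>j. real (\<alpha> j)) [0..<r]) $$ (i, j) = krawtchouk (n - 1) q j (real (\<alpha> i))" for r
    by (auto simp: M_def krawtchouk_mat_def simp del: upt_Suc)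
  \<comment> \<open>Position 0 holds the identity, positions 1 to m - 1 the relations inside blocks,
    and position m + i the relation between blocks with index i + 1.\<close>
  have R: "([Id_on X] @ map T [1..<m] @ map U [1..<s + 1]) ! 0 = Id_on X"
    "\<And>i. 1 \<le> i \<Longrightarrow> i < m \<Longrightarrow> ([Id_on X] @ map T [1..<m] @ map U [1..<s + 1]) ! i = same_block_rel q C (\<alpha> i)"
    "\<And>i. i < s \<Longrightarrow> ([Id_on X] @ map T [1..<m] @ map U [1..<s + 1]) ! (m + i) = diff_block_rel q C (\<alpha> (i + 1) - 1)"
    if "m \<ge> 1" for m
    using that by (auto simp: nth_Cons' nth_append T_def U_def simp del: upt_Suc)
  have "association_scheme X (2 * s - 1) ((!) ([Id_on X] @ map T [1..<s] @ map U [1..<s + 1])) \<and>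
      second_eigenmatrix X (2 * s - 1) ((!) ([Id_on X] @ map T [1..<s] @ map U [1..<s + 1]))
        (four_block_mat (M (map (\<lambda>j. real (\<alpha> j)) [0..<s])) ((real q - 1) \<cdot>\<^sub>m M (map (\<lambda>j. real (\<alpha> j)) [0..<s])) M\<^sub>U (- M\<^sub>U))"
    if "tight_odd_design n q s C"
  proof -
    \<comment> \<open>With \<open>m = s\<close> the formula \<open>entry\<close> has no column for
      \<open>rest\<close>, and the four blocks match its four cases.\<close>
    have Q: "four_block_mat (M (map (\<lambda>j. real (\<alpha> j)) [0..<s])) ((real q - 1) \<cdot>\<^sub>m M (map (\<lambda>j. real (\<alpha> j)) [0..<s])) M\<^sub>U (- M\<^sub>U)
      = mat (s + s) (s + s) (\<lambda>(i, j). entry s i j)"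
      using MU MT(1)[of s] MT(2)[of _ s] by (intro eq_matI) (auto simp: entry_def)
    have mm: "s = (if tight then s else s + 1)" using that tight_iff by simp
    have m1: "s \<ge> 1" using s by simp
    show ?thesis
      unfolding Q using scheme[OF mm R[OF m1], of "2 * s - 1"] s by simp
  qed
  moreover have "association_scheme X (2 * s) ((!) ([Id_on X] @ map T [1..<s + 1] @ map U [1..<s + 1])) \<and>
      second_eigenmatrix X (2 * s) ((!) ([Id_on X] @ map T [1..<s + 1] @ map U [1..<s + 1]))
        (four_block_mat (M (map (\<lambda>j. real (\<alpha> j)) [0..<s + 1]))
           (beside c ((real q - 1) \<cdot>\<^sub>m M (map (\<lambda>j. real (\<alpha> j)) [0..<s + 1])))
           M\<^sub>U (beside (0\<^sub>m s 1) (- M\<^sub>U)))"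
    if "\<not> tight_odd_design n q s C"
      and c: "c = mat (s + 1) 1 (\<lambda>(i, _).
                    if i = 0
                    then real (card C) - real q * (\<Sum>l = 0..s - 1. krawtchouk (n - 1) q l (real (\<alpha> 0)))
                    else - real q * (\<Sum>l = 0..s - 1. krawtchouk (n - 1) q l (real (\<alpha> i))))" for c
  proof -
    \<comment> \<open>This rests on s \<ge> 1: for s = 0 the truncated difference would leave the
      index 0 on the left.\<close>
    have "{0..s - 1} = {..<s}" using s by auto
    then have c': "c \<in> carrier_mat (s + 1) 1" "\<And>i. i < s + 1 \<Longrightarrow> c $$ (i, 0) = rest_entry i"
      by (auto simp: c rest_entry_def)
    \<comment> \<open>The column glued on by \<open>beside\<close> becomes column \<open>s\<close>,
      the place of \<open>rest\<close> in \<open>entry (s + 1)\<close>.\<close>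
    have Q: "four_block_mat (M (map (\<lambda>j. real (\<alpha> j)) [0..<s + 1]))
           (beside c ((real q - 1) \<cdot>\<^sub>m M (map (\<lambda>j. real (\<alpha> j)) [0..<s + 1])))
           M\<^sub>U (beside (0\<^sub>m s 1) (- M\<^sub>U))
      = mat (s + 1 + s) (s + 1 + s) (\<lambda>(i, j). entry (s + 1) i j)"
      using MU MT(1)[of "s + 1"] MT(2)[of _ "s + 1"] c'
      by (intro eq_matI) (auto simp: entry_def beside_def simp del: upt_Suc)
    have mm: "s + 1 = (if tight then s else s + 1)" using that tight_iff by simp
    have m1: "s + 1 \<ge> 1" using s by simp
    show ?thesis
      unfolding Q using scheme[OF mm R[OF m1], of "2 * s"] by simp
  qed
  ultimately show ?thesis
    unfolding Let_def T_def U_def M_def M\<^sub>U_def by blast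
qed

end
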